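(* Let $0<|q|<1$, let $r,s$ be non-negative integers with $r<s$, and let $\mathbf a=(a_1,\ldots,a_r)$, $\mathbf b=(b_1,\ldots,b_s)$ be nonzero complex numbers for which all expressions below are defined (no denominator vanishes). Then \begin{align*} &\frac{(q;q)_\infty^2\,[a_1,\ldots,a_r]_\infty}{[b_1,\ldots,b_s]_\infty}\bigl(1-\mathcal{S}(\mathbf a)+\mathcal{S}(\mathbf b)\bigr)\\ &=\sum_{k=1}^{s}\frac{\prod_{i=1}^r[a_i/b_k]_\infty}{\prod_{j\neq k}[b_j/b_k]_\infty}\sum_{n=-\infty}^{\infty}\frac{(-1)^{(s-r)n}q^{(s-r)n(n+1)/2}}{(1-b_kq^n)^2}\left(\frac{a_1\cdots a_r\, b_k^{s-r-1}}{\prod_{j\neq k}b_j}\right)^{n}. \end{align*} For $r=s$ the same identity holds provided $|q|<\left|\frac{a_1\cdots a_r}{b_1\cdots b_s}\right|<1$.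
   Context: Notation: $(a;q)_\infty=\prod_{n\ge0}(1-aq^n)$, $[a]_\infty=(a;q)_\infty(q/a;q)_\infty$, and $[a_1,\ldots,a_k]_\infty=[a_1]_\infty\cdots[a_k]_\infty$. For a finite sequence $\mathbf a=(a_1,\ldots,a_r)$ the series $\mathcal S$ is defined by $\mathcal{S}(a_1,\ldots,a_r)=\mathcal S(a_1,\ldots,a_r;q)=\sum_{u=1}^r\sum_{n=0}^\infty\left(\frac{1}{1-a_uq^n}-\frac{1}{1-a_u^{-1}q^{n+1}}\right)$ (the inner sum taken termwise as written), with $\mathcal S$ of the empty sequence equal to $0$. Products over $j\neq k$ range over $j\in\{1,\ldots,s\}\setminus\{k\}$. *)

theory Defs
  imports "HOL-Analysis.Analysis"
begin

definition qpoch_inf :: "complex \<Rightarrow> complex \<Rightarrow> complex" where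
  "qpoch_inf a q = (\<Prod>n. 1 - a * q ^ n)"

(* The bracket [a]_\<infinity> to the base q; [a_1,...,a_k]_\<infinity> is written
   out as a finite product of these. *)
definition qbracket :: "complex \<Rightarrow> complex \<Rightarrow> complex" where
  "qbracket q a = qpoch_inf a q * qpoch_inf (q / a) q"

(* The sequence (a_1,...,a_r) is the restriction of a to {1..r}.  The two fractions
   are summed together: neither series converges on its own, since its terms tend to 1. *)
definition qS :: "complex \<Rightarrow> nat \<Rightarrow> (nat \<Rightarrow> complex) \<Rightarrow> complex" where
  "qS q r a = (\<Sum>u=1..r. \<Sum>n. 1 / (1 - a u * q ^ n) - 1 / (1 - inverse (a u) * q ^ (n + 1)))"

definition qS_defined :: "complex \<Rightarrow> nat \<Rightarrow> (nat \<Rightarrow> complex) \<Rightarrow> bool" where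
  "qS_defined q r a \<longleftrightarrow>
     (\<forall>u\<in>{1..r}. \<forall>n::nat. 1 - a u * q ^ n \<noteq> 0 \<and> 1 - inverse (a u) * q ^ (n + 1) \<noteq> 0)"

(* The n-th term of the bilateral series attached to b_k.  The exponent s - r - 1 is an
   integer, equal to -1 when r = s; n (n + 1) is even, so div is exact. *)
definition bilat_term ::
  "complex \<Rightarrow> nat \<Rightarrow> nat \<Rightarrow> (nat \<Rightarrow> complex) \<Rightarrow> (nat \<Rightarrow> complex) \<Rightarrow> nat \<Rightarrow> int \<Rightarrow> complex" where
  "bilat_term q r s a b k n =
     (-1) powi ((int s - int r) * n) * q powi ((int s - int r) * (n * (n + 1) div 2))
       / (1 - b k * q powi n)\<^sup>2
       * ((\<Prod>i=1..r. a i) * b k powi (int s - int r - 1) / (\<Prod>j\<in>{1..s} - {k}. b j)) powi n"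

end

(* Put F(w) = (q;q)_inf^2 [a_1 w,...,a_r w]_inf / [b_1 w,...,b_s w]_inf, so that
   F(qw) = c w^(s-r) F(w) with c = (-1)^(s-r) (b_1...b_s)/(a_1...a_r).  Integrate
   F(w) w / (w-1)^2 over the circles of radius rho |q|^N and rho |q|^(-N), where rho avoids
   the moduli of all poles.  By the quasiperiodicity and the growth condition both integrals
   tend to 0, hence the sum of all residues in the punctured plane vanishes.  The double pole
   at w = 1 contributes the derivative of w F(w) there, F(1) (1 - S(a) + S(b)); the simple pole
   at q^(-n)/b_k contributes the n-th term of the k-th bilateral series with opposite sign. *)
theory Submission
  imports Defs "HOL-Complex_Analysis.Complex_Analysis"
begin

section \<open>Residues in an annulus\<close>

text \<open>The kernel carries the factor w because of the simple poles: at p = q^(-n)/b_k one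
  factor p comes from w - p = -p (1 - b_k q^n w), a second one from the kernel, and p^2 / (p - 1)^2
  = 1 / (1 - b_k q^n)^2 is the denominator of the series. The poles accumulate at 0 and at infinity,
  so residues can be summed only over annuli, each containing finitely many poles. Multiplication by
  powers of q carries the circle of radius rho to all the others, so one compactness bound for F on
  it suffices. For r < s the powers of w in the functional equation make F decay rapidly in both
  directions along these circles. For r = s its size changes by |c|^N inward and |c|^(-N) outward:
  the outer integrals need 1/|c| < 1, and the inner ones need |c|^N to be beaten by the smallness of
  the circle and kernel, which |q| < 1/|c| guarantees. The annuli yield finite partial sums over
  index sets exhausting the integers. Summability of the bilateral series is established separately
  and identifies their limit with the unordered sum.\<close>

text \<open>A slit traversed in both directions turns the two circles into one closed path, whose
  winding number is the difference of theirs: 1 between the circles, 0 inside the smaller and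
  outside the larger one. \<open>S\<close> has to contain the closed annulus only, so it may omit
  0.\<close>

lemma annulus_residue_theorem:
  fixes f :: "complex \<Rightarrow> complex"
  assumes r: "0 < r" "r < R" and S: "open S" "connected S" "cball 0 R - ball 0 r \<subseteq> S"
    and pts: "finite pts" "pts \<inter> sphere 0 r = {}" "pts \<inter> sphere 0 R = {}"
    and holo: "f holomorphic_on S - pts"
  shows "contour_integral (circlepath 0 R) f - contour_integral (circlepath 0 r) f
           = 2 * pi * \<i> * (\<Sum>p\<in>{p\<in>pts. r < norm p \<and> norm p < R}. residue f p)"
proof -
  define e where "e = (\<lambda>t::real. exp (2 * of_real pi * \<i> * of_real t))"
  have norm_e: "norm (e t) = 1" for t unfolding e_def by simp
  \<comment> \<open>The directions \<open>e t\<close> are infinitely many, those of the points of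
    \<open>pts\<close> finitely many; hence some ray from 0 misses all singularities.\<close>
  obtain t where t: "t \<in> {0<..<1}" "\<And>x::real. x > 0 \<Longrightarrow> of_real x * e t \<notin> pts"
  proof -
    have "inj_on e {0<..<1}"
    proof (rule inj_onI)
      fix x y :: real assume xy: "x \<in> {0<..<1}" "y \<in> {0<..<1}" "e x = e y"
      then obtain n :: int where "2 * of_real pi * \<i> * of_real x = 2 * of_real pi * \<i> * of_real y + of_int (2 * n) * of_real pi * \<i>"
        unfolding e_def exp_eq by auto
      hence "of_real (2 * pi * x) * \<i> = of_real (2 * pi * y + 2 * n * pi) * \<i>" by (simp add: algebra_simps)
      hence "2 * pi * x = 2 * pi * y + 2 * n * pi"
        by (metis complex_i_not_zero mult_right_cancel of_real_eq_iff)
      hence "2 * pi * (x - y) = 2 * pi * n" by (simp add: algebra_simps)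
      hence "x - y = of_int n" by simp
      moreover from this have "-1 < real_of_int n" "real_of_int n < 1" using xy by auto
      hence "n = 0" by linarith
      ultimately show "x = y" by simp
    qed
    hence "infinite (e ` {0<..<1})" by (simp add: finite_image_iff infinite_Ioo)
    hence "infinite (e ` {0<..<1} - sgn ` pts)" using pts(1) by simp
    then obtain z where "z \<in> e ` {0<..<1} - sgn ` pts" by (metis all_not_in_conv finite.emptyI)
    then obtain t where t: "t \<in> {0<..<1}" "e t \<notin> sgn ` pts" by auto
    have "of_real x * e t \<notin> pts" if "x > 0" for x :: real
    proof
      assume "of_real x * e t \<in> pts"
      moreover have "sgn (of_real x * e t) = e t"
        using that norm_e by (simp add: sgn_eq norm_mult)
      ultimately show False using t(2) by (metis imageI)
    qed
    with t(1) that show ?thesis by blast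
  qed
  \<comment> \<open>Restarting the circles in the direction \<open>e t\<close> puts their endpoints
    on the chosen ray; integrals and winding numbers do not change.\<close>
  define C where "C = (\<lambda>x::real. shiftpath t (circlepath 0 x))"
  have t': "t \<in> {0..1}" using t(1) by auto
  have C_start: "pathstart (C x) = of_real x * e t" for x
    using t' by (simp add: C_def pathstart_shiftpath circlepath e_def mult_ac)
  have C_finish: "pathfinish (C x) = of_real x * e t" for x
  proof -
    have "pathfinish (C x) = pathstart (C x)"
      unfolding C_def by (rule closed_shiftpath) (use t' in auto)
    thus ?thesis by (simp add: C_start)
  qed
  have C_valid: "valid_path (C x)" for x
    unfolding C_def by (rule valid_path_shiftpath) (use t' in auto)
  have C_image: "path_image (C x) = sphere 0 x" if "x > 0" for x
    unfolding C_def using t' that by (subst path_image_shiftpath) auto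
  have C_int: "contour_integral (C x) f = contour_integral (circlepath 0 x) f" for x
    unfolding C_def by (rule contour_integral_shiftpath) (use t' in auto)
  have C_wind: "winding_number (C x) z = winding_number (circlepath 0 x) z" if "norm z \<noteq> x" "x > 0" for x z
    unfolding C_def by (rule winding_number_shiftpath) (use t' that in auto)
  \<comment> \<open>The two circles are joined by a slit at an angle \<open>t\<close> that misses the finitely many singularities.\<close>
  define L where "L = linepath (of_real r * e t) (of_real R * e t)"
  have L_pts: "\<exists>x. r \<le> x \<and> x \<le> R \<and> z = of_real x * e t" if "z \<in> path_image L" for z
  proof -
    from that obtain u where u: "0 \<le> u" "u \<le> 1" "z = (1 - u) *\<^sub>R (of_real r * e t) + u *\<^sub>R (of_real R * e t)"
      by (auto simp: L_def path_image_linepath closed_segment_def)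
    have "(1 - u) * r + u * R = r + u * (R - r)" by (simp add: algebra_simps)
    moreover have "0 \<le> u * (R - r)" "u * (R - r) \<le> R - r"
      using u r mult_right_mono[of u 1 "R - r"] by auto
    ultimately have "r \<le> (1 - u) * r + u * R" "(1 - u) * r + u * R \<le> R" by linarith+
    moreover have "z = of_real ((1 - u) * r + u * R) * e t"
      by (simp add: u(3) scaleR_conv_of_real algebra_simps)
    ultimately show ?thesis by blast
  qed
  have L_S: "path_image L \<subseteq> S - pts"
  proof
    fix z assume "z \<in> path_image L"
    then obtain x where x: "r \<le> x" "x \<le> R" "z = of_real x * e t" using L_pts by blast
    hence "norm z = x" using r by (simp add: norm_mult norm_e)
    hence "z \<in> S" using S(3) x by (auto simp: subset_iff)
    with x t(2)[of x] r show "z \<in> S - pts" by auto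
  qed
  have C_S: "path_image (C R) \<subseteq> S - pts" "path_image (C r) \<subseteq> S - pts"
    using S(3) pts r by (auto simp: C_image subset_iff disjoint_iff)
  define g where "g = C R +++ reversepath L +++ reversepath (C r) +++ L"
  have L_ends: "pathstart L = of_real r * e t" "pathfinish L = of_real R * e t"
    by (auto simp: L_def)
  note ends = L_ends C_start C_finish
  have valid_L: "valid_path L" by (simp add: L_def)
  have g_valid: "valid_path g"
    unfolding g_def by (intro valid_path_join) (auto simp: ends C_valid valid_L)
  have g_image: "path_image g = sphere 0 R \<union> sphere 0 r \<union> path_image L"
    unfolding g_def using r by (auto simp: path_image_join ends C_image)
  \<comment> \<open>The two passages along the slit cancel, and the reversed inner circle counts
    negatively.\<close>
  have wind: "winding_number g z = winding_number (circlepath 0 R) z - winding_number (circlepath 0 r) z"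
    if "z \<notin> path_image g" for z
  proof -
    have "winding_number g z = winding_number (C R) z - winding_number L z - winding_number (C r) z + winding_number L z"
      unfolding g_def using that r g_image
      by (simp add: winding_number_join winding_number_reversepath ends C_valid valid_L
             valid_path_imp_path path_image_join C_image)
    also have "\<dots> = winding_number (circlepath 0 R) z - winding_number (circlepath 0 r) z"
      using that r g_image by (simp add: C_wind)
    finally show ?thesis .
  qed
  have wind_out: "winding_number (circlepath 0 x) z = 0" if "norm z > x" "x > 0" for x z
    by (rule winding_number_zero_outside[of _ "cball 0 x"]) (use that in auto)
  have wind_in: "winding_number (circlepath 0 x) z = 1" if "norm z < x" for x z
    using that by (intro winding_number_circlepath) auto
  have "contour_integral g f = 2 * pi * \<i> * (\<Sum>p\<in>pts. winding_number g p * residue f p)"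
  proof (rule Residue_theorem[OF S(1,2) pts(1) holo g_valid])
    show "pathfinish g = pathstart g" by (simp add: g_def ends)
    show "path_image g \<subseteq> S - pts"
      using L_S C_S r by (auto simp: g_image C_image)
    show "\<forall>z. z \<notin> S \<longrightarrow> winding_number g z = 0"
    proof (intro allI impI)
      fix z assume z: "z \<notin> S"
      hence "norm z < r \<or> norm z > R" using S(3) by (force simp: subset_iff)
      moreover have "z \<notin> path_image g" using L_S C_S z r by (auto simp: g_image C_image)
      ultimately show "winding_number g z = 0"
        using r by (auto simp: wind wind_in wind_out)
    qed
  qed
  also have "(\<Sum>p\<in>pts. winding_number g p * residue f p)
      = (\<Sum>p\<in>{p\<in>pts. r < norm p \<and> norm p < R}. residue f p)"
  proof (rule sum.mono_neutral_cong_right)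
    show "finite pts" by fact
    have ng: "p \<notin> path_image g" if "p \<in> pts" for p using L_S that pts by (auto simp: g_image)
    show "\<forall>i\<in>pts - {p \<in> pts. r < norm p \<and> norm p < R}. winding_number g i * residue f i = 0"
    proof
      fix p assume p: "p \<in> pts - {p \<in> pts. r < norm p \<and> norm p < R}"
      hence "norm p \<noteq> r" "norm p \<noteq> R" using pts(2,3) by auto
      hence "norm p < r \<or> norm p > R" using p by auto
      with r ng[of p] p show "winding_number g p * residue f p = 0"
        by (auto simp: wind wind_in wind_out)
    qed
    show "winding_number g p * residue f p = residue f p" if "p \<in> {p \<in> pts. r < norm p \<and> norm p < R}" for p
      using that ng[of p] r by (auto simp: wind wind_in wind_out)
  qed auto
  also have "contour_integral g f = contour_integral (C R) f - contour_integral (C r) f"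
  proof -
    have op: "open (S - pts)" using S(1) pts(1) by (simp add: finite_imp_closed open_Diff)
    have i: "f contour_integrable_on C R" "f contour_integrable_on C r" "f contour_integrable_on L"
      using contour_integrable_holomorphic_simple[OF holo op] C_S L_S C_valid valid_L by auto
    hence i': "f contour_integrable_on reversepath (C r)" "f contour_integrable_on reversepath L"
      by (auto intro: contour_integrable_reversepath C_valid valid_L)
    show ?thesis unfolding g_def using i i'
      by (simp add: contour_integral_join C_valid valid_L ends contour_integral_reversepath)
  qed
  finally show ?thesis by (simp add: C_int)
qed

section \<open>The infinite product and the theta bracket\<close>

locale nome =
  fixes q :: complex
  assumes q_pos: "0 < norm q" and q_less: "norm q < 1"
begin

lemma q_nz [simp]: "q \<noteq> 0"
  using q_pos by auto

lemma convergent_prod_qpoch: "convergent_prod (\<lambda>n. 1 - a * q ^ n)"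
proof -
  have "summable (\<lambda>n. norm a * norm q ^ n)"
    by (intro summable_mult summable_geometric) (use q_less in auto)
  hence "abs_convergent_prod (\<lambda>n. 1 - a * q ^ n)"
    by (simp add: abs_convergent_prod_conv_summable norm_mult norm_power)
  thus ?thesis by (rule abs_convergent_prod_imp_convergent_prod)
qed

lemma has_prod_qpoch: "(\<lambda>n. 1 - a * q ^ n) has_prod qpoch_inf a q"
  unfolding qpoch_inf_def by (intro convergent_prod_has_prod convergent_prod_qpoch)

lemma qpoch_eq_0_iff: "qpoch_inf a q = 0 \<longleftrightarrow> (\<exists>n. a * q ^ n = 1)"
  using has_prod_eq_0_iff[OF has_prod_qpoch, of a] by (auto simp: image_iff)

lemma qpoch_split: "qpoch_inf a q = (1 - a) * qpoch_inf (a * q) q"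
proof (cases "a = 1")
  case True
  thus ?thesis using qpoch_eq_0_iff[of 1] by (auto intro: exI[of _ 0])
next
  case False
  thus ?thesis
    unfolding qpoch_inf_def using prodinf_split_head[OF convergent_prod_qpoch, of a]
    by (simp add: field_simps)
qed

text \<open>The M-test with majorant B |q|^n, where B bounds the compact set. Uniformity is what
  later gives holomorphy in x and termwise logarithmic differentiation.\<close>

lemma uniform_limit_qpoch:
  assumes "compact A"
  shows "uniform_limit A (\<lambda>N x. \<Prod>n<N. 1 - x * q ^ n) (\<lambda>x. qpoch_inf x q) sequentially"
proof -
  obtain B where B: "\<And>x. x \<in> A \<Longrightarrow> norm x \<le> B"
    using compact_imp_bounded[OF assms] by (auto simp: bounded_iff)
  have "uniformly_convergent_on A (\<lambda>N x. \<Prod>n<N. 1 - x * q ^ n)"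
  proof (rule uniformly_convergent_on_prod'[OF _ assms])
    show "uniformly_convergent_on A (\<lambda>N x. \<Sum>n<N. norm (1 - x * q ^ n - 1))"
    proof (rule Weierstrass_m_test')
      show "norm (norm (1 - x * q ^ n - 1)) \<le> B * norm q ^ n" if "x \<in> A" for n x
        using that by (auto simp: norm_mult norm_power intro!: mult_right_mono B)
      show "summable (\<lambda>n. B * norm q ^ n)"
        by (intro summable_mult summable_geometric) (use q_less in auto)
    qed
  qed (auto intro!: continuous_intros)
  then obtain l where l: "uniform_limit A (\<lambda>N x. \<Prod>n<N. 1 - x * q ^ n) l sequentially"
    by (auto simp: uniformly_convergent_on_def)
  have "l x = qpoch_inf x q" if "x \<in> A" for x
  proof -
    have "(\<lambda>N. \<Prod>n<N. 1 - x * q ^ n) \<longlonglongrightarrow> l x"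
      by (rule tendsto_uniform_limitI[OF l that])
    moreover have "(\<lambda>N. \<Prod>n<N. 1 - x * q ^ n) \<longlonglongrightarrow> qpoch_inf x q"
      by (rule has_prod_imp_tendsto'[OF has_prod_qpoch])
    ultimately show ?thesis by (rule LIMSEQ_unique)
  qed
  with l show ?thesis using uniform_limit_cong'[of A] by (smt (verit, best))
qed

lemma holomorphic_qpoch: "(\<lambda>x. qpoch_inf x q) holomorphic_on A"
proof -
  have "(\<lambda>x. qpoch_inf x q) holomorphic_on UNIV"
  proof (rule holomorphic_uniform_sequence[OF open_UNIV])
    show "(\<lambda>x. \<Prod>n<N. 1 - x * q ^ n) holomorphic_on UNIV" for N
      by (intro holomorphic_intros)
    show "\<exists>d>0. cball x d \<subseteq> UNIV \<and> uniform_limit (cball x d) (\<lambda>N x. \<Prod>n<N. 1 - x * q ^ n) (\<lambda>x. qpoch_inf x q) sequentially" for x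
      by (intro exI[of _ 1]) (auto intro!: uniform_limit_qpoch)
  qed
  thus ?thesis by (rule holomorphic_on_subset) auto
qed

lemma holomorphic_qpoch' [holomorphic_intros]:
  assumes "f holomorphic_on A"
  shows "(\<lambda>x. qpoch_inf (f x) q) holomorphic_on A"
  using holomorphic_on_compose[OF assms holomorphic_qpoch] by (simp add: o_def)

lemma logderiv_qpoch:
  assumes "qpoch_inf a q \<noteq> 0"
  shows "(\<lambda>n. - (q ^ n) / (1 - a * q ^ n)) sums (deriv (\<lambda>x. qpoch_inf x q) a / qpoch_inf a q)"
proof -
  have "(\<lambda>n. deriv (\<lambda>x. 1 - x * q ^ n) a / (1 - a * q ^ n)) sums (deriv (\<lambda>x. qpoch_inf x q) a / qpoch_inf a q)"
    by (rule logderiv_prodinf_complex_uniform_limit[where A = "ball a 1" and P = "\<lambda>x. qpoch_inf x q"])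
       (use assms in \<open>auto intro!: holomorphic_intros uniform_limit_on_subset[OF uniform_limit_qpoch[of "cball a 1"]]\<close>)
  also have "(\<lambda>n. deriv (\<lambda>x. 1 - x * q ^ n) a / (1 - a * q ^ n)) = (\<lambda>n. - (q ^ n) / (1 - a * q ^ n))"
  proof
    fix n
    have "deriv (\<lambda>x. 1 - x * q ^ n) a = - (q ^ n)"
      by (rule DERIV_imp_deriv) (auto intro!: derivative_eq_intros)
    thus "deriv (\<lambda>x. 1 - x * q ^ n) a / (1 - a * q ^ n) = - (q ^ n) / (1 - a * q ^ n)" by simp
  qed
  finally show ?thesis .
qed

lemma has_field_derivative_qpoch:
  "((\<lambda>x. qpoch_inf x q) has_field_derivative deriv (\<lambda>x. qpoch_inf x q) a) (at a)"
  by (rule holomorphic_derivI[OF holomorphic_qpoch[of UNIV]]) auto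

lemma holomorphic_qbracket [holomorphic_intros]:
  assumes "f holomorphic_on A" "\<And>x. x \<in> A \<Longrightarrow> f x \<noteq> 0"
  shows "(\<lambda>x. qbracket q (f x)) holomorphic_on A"
  unfolding qbracket_def by (intro holomorphic_intros assms)

text \<open>The first product of the bracket supplies the exponents n \<ge> 0, the second one the
  exponents n < 0.\<close>

lemma qbracket_eq_0_iff:
  assumes "z \<noteq> 0"
  shows "qbracket q z = 0 \<longleftrightarrow> (\<exists>n::int. z * q powi n = 1)"
proof -
  have "qpoch_inf (q / z) q = 0 \<longleftrightarrow> (\<exists>n. z * q powi (- int (Suc n)) = 1)"
    using assms by (auto simp: qpoch_eq_0_iff power_int_minus field_simps simp del: of_nat_Suc)
  moreover have "qpoch_inf z q = 0 \<longleftrightarrow> (\<exists>n. z * q powi int n = 1)"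
    by (simp add: qpoch_eq_0_iff)
  moreover have "(\<exists>n::int. z * q powi n = 1) \<longleftrightarrow>
      (\<exists>n. z * q powi int n = 1) \<or> (\<exists>n. z * q powi (- int (Suc n)) = 1)"
    by (metis int_cases)
  ultimately show ?thesis by (simp add: qbracket_def del: of_nat_Suc)
qed

text \<open>Isolates the zero at z = 1. There the cofactor equals (q;q)^2, which is what cancels the
  same factor of the theta quotient in the residues.\<close>

lemma qbracket_factor:
  "qbracket q z = (1 - z) * (qpoch_inf (z * q) q * qpoch_inf (q / z) q)"
  unfolding qbracket_def by (subst qpoch_split) simp

text \<open>Passing from z to z q drops the factor 1 - z from the first product and adds 1 - 1/z to
  the second; the quotient of these is -1/z.\<close>

lemma qbracket_mult_q:
  assumes "z \<noteq> 0"
  shows "qbracket q (z * q) = - qbracket q z / z"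
proof -
  have "qpoch_inf (q / (z * q)) q = qpoch_inf (1 / z) q" by simp
  also have "\<dots> = (1 - 1 / z) * qpoch_inf (q / z) q"
    by (subst qpoch_split) simp
  finally have *: "qpoch_inf (q / (z * q)) q = (1 - 1 / z) * qpoch_inf (q / z) q" .
  have "qbracket q (z * q) = (1 - 1 / z) * (qpoch_inf (z * q) q * qpoch_inf (q / z) q)"
    unfolding qbracket_def * by (simp add: mult_ac)
  moreover have "1 - 1 / z = - ((1 - z) / z)" using assms by (simp add: field_simps)
  ultimately show ?thesis
    by (simp only: qbracket_factor[of z] mult_minus_left times_divide_eq_left minus_divide_left)
qed

text \<open>This is where the series S comes from. The first product contributes the terms 1/(1 - a
  q^n) - 1, the second 1 - 1/(1 - q^(n+1)/a); the constants cancel only when both are added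
  termwise.\<close>

lemma logderiv_qbracket:
  assumes "a \<noteq> 0" "qbracket q a \<noteq> 0"
  shows "((\<lambda>z. qbracket q (a * z)) has_field_derivative
           - qbracket q a * (\<Sum>n. 1 / (1 - a * q ^ n) - 1 / (1 - inverse a * q ^ (n + 1)))) (at 1)"
proof -
  define P where "P = (\<lambda>x. qpoch_inf x q)"
  have nz: "P a \<noteq> 0" "P (q / a) \<noteq> 0" using assms by (auto simp: qbracket_def P_def)
  have nz1: "1 - a * q ^ n \<noteq> 0" for n using nz(1) qpoch_eq_0_iff[of a] by (auto simp: P_def)
  have nz2: "1 - q / a * q ^ n \<noteq> 0" for n using nz(2) qpoch_eq_0_iff[of "q / a"] by (auto simp: P_def)
  have s1: "(\<lambda>n. - (q ^ n) / (1 - a * q ^ n)) sums (deriv P a / P a)"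
    unfolding P_def by (rule logderiv_qpoch) (use nz in \<open>auto simp: P_def\<close>)
  have s2: "(\<lambda>n. - (q ^ n) / (1 - q / a * q ^ n)) sums (deriv P (q / a) / P (q / a))"
    unfolding P_def by (rule logderiv_qpoch) (use nz in \<open>auto simp: P_def\<close>)
  have "(\<lambda>n. - a * (- (q ^ n) / (1 - a * q ^ n)) + q / a * (- (q ^ n) / (1 - q / a * q ^ n))) sums
      (- a * (deriv P a / P a) + q / a * (deriv P (q / a) / P (q / a)))"
    by (intro sums_add sums_mult s1 s2)
  also have "(\<lambda>n. - a * (- (q ^ n) / (1 - a * q ^ n)) + q / a * (- (q ^ n) / (1 - q / a * q ^ n)))
     = (\<lambda>n. 1 / (1 - a * q ^ n) - 1 / (1 - inverse a * q ^ (n + 1)))"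
  proof
    fix n
    have *: "- a * (- (q ^ n) / (1 - a * q ^ n)) = 1 / (1 - a * q ^ n) - 1"
      using nz1[of n] by (simp add: divide_simps)
    have **: "q / a * (- (q ^ n) / (1 - q / a * q ^ n)) = 1 - 1 / (1 - q / a * q ^ n)"
    proof -
      define d where "d = 1 - q / a * q ^ n"
      have "q / a * q ^ n = 1 - d" by (simp add: d_def)
      hence "q / a * (- (q ^ n) / d) = - (1 - d) / d" by (metis mult_minus_right times_divide_eq_right)
      also have "\<dots> = 1 - 1 / d" using nz2[of n, folded d_def] by (simp add: diff_divide_distrib)
      finally show ?thesis by (simp add: d_def)
    qed
    have "inverse a * q ^ (n + 1) = q / a * q ^ n" by (simp add: field_simps)
    with * ** show "- a * (- (q ^ n) / (1 - a * q ^ n)) + q / a * (- (q ^ n) / (1 - q / a * q ^ n))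
      = 1 / (1 - a * q ^ n) - 1 / (1 - inverse a * q ^ (n + 1))" by simp
  qed
  finally have S: "(\<Sum>n. 1 / (1 - a * q ^ n) - 1 / (1 - inverse a * q ^ (n + 1)))
      = - a * (deriv P a / P a) + q / a * (deriv P (q / a) / P (q / a))"
    by (simp add: sums_iff)
  have d1: "((\<lambda>z. P (a * z)) has_field_derivative deriv P a * a) (at 1)"
    by (rule DERIV_chain2[where f = P]) (use has_field_derivative_qpoch[of a] in \<open>auto simp: P_def intro!: derivative_eq_intros\<close>)
  have d2: "((\<lambda>z. P (q / (a * z))) has_field_derivative deriv P (q / a) * (- q / a)) (at 1)"
    by (rule DERIV_chain2[where f = P]) (use assms has_field_derivative_qpoch[of "q / a"] in \<open>auto simp: P_def field_simps power2_eq_square intro!: derivative_eq_intros\<close>)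
  have "((\<lambda>z. qbracket q (a * z)) has_field_derivative
      deriv P a * a * P (q / a) + deriv P (q / a) * (- q / a) * P a) (at 1)"
    unfolding qbracket_def P_def[symmetric]
    using DERIV_mult[OF d1 d2] by (simp add: P_def)
  also have "deriv P a * a * P (q / a) + deriv P (q / a) * (- q / a) * P a
     = - qbracket q a * (- a * (deriv P a / P a) + q / a * (deriv P (q / a) / P (q / a)))"
  proof -
    have "qbracket q a = P a * P (q / a)" by (simp add: qbracket_def P_def)
    thus ?thesis using nz by (simp add: field_simps)
  qed
  finally show ?thesis by (simp only: S)
qed

end

section \<open>Quasiperiodic functions\<close>

text \<open>Comparison with a geometric series whose ratio \<open>d\<close> lies between |L| and 1.
  A recursion with factor \<open>g n\<close>, rather than a quotient, allows terms to vanish. In the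
  applications L distinguishes m = 0 from m > 0.\<close>

lemma summable_norm_ratio_limit:
  fixes f g :: "nat \<Rightarrow> 'a :: real_normed_field"
  assumes "\<And>n. f (Suc n) = f n * g n" "g \<longlonglongrightarrow> L" "norm L < 1"
  shows "summable (\<lambda>n. norm (f n))"
proof -
  obtain d where d: "norm L < d" "d < 1" using assms(3) dense by blast
  have "eventually (\<lambda>n. norm (g n) < d) sequentially"
    using tendsto_norm[OF assms(2)] d(1) by (rule order_tendstoD)
  then obtain N where N: "\<And>n. n \<ge> N \<Longrightarrow> norm (g n) < d"
    by (auto simp: eventually_sequentially)
  show ?thesis
  proof (rule summable_ratio_test[OF d(2)])
    show "norm (norm (f (Suc n))) \<le> d * norm (norm (f n))" if "n \<ge> N" for n
      using mult_right_mono[OF less_imp_le[OF N[OF that]], of "norm (f n)"]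
      by (simp add: assms(1) norm_mult mult.commute)
  qed
qed

lemma summable_on_int_from_halves:
  fixes f :: "int \<Rightarrow> 'a :: banach"
  assumes "summable (\<lambda>n. norm (f (int n)))" "summable (\<lambda>n. norm (f (- int n)))"
  shows "f summable_on UNIV"
proof -
  have 1: "f summable_on range int"
    by (subst summable_on_reindex) (use assms(1) in \<open>auto simp: o_def intro: norm_summable_imp_summable_on\<close>)
  have 2: "f summable_on range (\<lambda>n. - int n)"
    by (subst summable_on_reindex) (use assms(2) in \<open>auto simp: o_def inj_def intro: norm_summable_imp_summable_on\<close>)
  \<comment> \<open>The index 0 belongs to both halves, so the overlap is removed from one of
    them.\<close>
  have "f summable_on range (\<lambda>n. - int n) - range int"
    by (rule summable_on_subset_banach[OF 2]) auto
  with 1 have "f summable_on (range int \<union> (range (\<lambda>n. - int n) - range int))"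
    by (rule summable_on_Un_disjoint) auto
  moreover have "range int \<union> (range (\<lambda>n. - int n) - range int) = UNIV"
    using int_cases2 by blast
  ultimately show ?thesis by simp
qed

text \<open>A non-integrable function has \<open>contour_integral\<close> 0 by convention, so the
  bound covers that case too.\<close>

lemma norm_contour_integral_circlepath_le:
  assumes "0 \<le> B" "0 < r" "\<And>x. norm x = r \<Longrightarrow> norm (f x) \<le> B"
  shows "norm (contour_integral (circlepath 0 r) f) \<le> B * (2 * pi * r)"
proof (cases "f contour_integrable_on circlepath 0 r")
  case True
  show ?thesis
    by (rule has_contour_integral_bound_circlepath[OF has_contour_integral_integral[OF True]])
       (use assms in auto)
next
  case False
  with assms show ?thesis by (simp add: not_integrable_contour_integral)
qed

context nome
begin

text \<open>
  The factor by which a solution of \<open>F (z * q) = c * z ^ m * F z\<close> changes from \<open>u\<close> to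
  \<open>u * q powi (- n)\<close>; the sign of \<open>n\<close> is that of the bilateral series.
\<close>

definition twist :: "complex \<Rightarrow> nat \<Rightarrow> complex \<Rightarrow> int \<Rightarrow> complex" where
  "twist c m u n = c powi (- n) * u powi (- (int m * n)) * q powi (int m * (n * (n + 1) div 2))"

lemma twist_0 [simp]: "twist c m u 0 = 1"
  by (simp add: twist_def)

text \<open>The functional equation at v = u q^(-n-1), solved for F v: the factor 1/v^m is
  (q^(n+1)/u)^m. In the closed form, n(n+1)/2 grows by n + 1. The same recursion serves the
  induction and the ratio tests.\<close>

lemma twist_succ:
  assumes "c \<noteq> 0" "u \<noteq> 0"
  shows "twist c m u (n + 1) = twist c m u n * (q powi (n + 1) / u) ^ m / c"
proof -
  have "(n + 1) * (n + 1 + 1) = n * (n + 1) + 2 * (n + 1)" by (simp add: algebra_simps)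
  hence "(n + 1) * (n + 1 + 1) div 2 = n * (n + 1) div 2 + (n + 1)" by simp
  hence "q powi (int m * ((n + 1) * (n + 1 + 1) div 2))
      = q powi (int m * (n * (n + 1) div 2)) * q powi ((n + 1) * int m)"
    by (simp add: distrib_left power_int_add mult.commute del: div_mult_self1 div_mult_self2 div_mult_self3 div_mult_self4)
  moreover have "q powi ((n + 1) * int m) = (q powi (n + 1)) ^ m"
    by (simp add: power_int_mult)
  moreover have "u powi (- (int m * (n + 1))) = u powi (- (int m * n)) / u ^ m"
  proof -
    have "- (int m * (n + 1)) = - (int m * n) - int m" by (simp add: algebra_simps)
    thus ?thesis using assms(2) by (simp add: power_int_diff)
  qed
  moreover have "c powi (- (n + 1)) = c powi (- n) / c"
  proof -
    have "- (n + 1) = - n - 1" by simp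
    thus ?thesis using assms(1) power_int_diff[of c "- n" 1] by simp
  qed
  ultimately show ?thesis
    unfolding twist_def by (simp add: power_divide mult_ac)
qed

lemma twist_pred:
  assumes "c \<noteq> 0" "u \<noteq> 0"
  shows "twist c m u (n - 1) = twist c m u n * c * (u * q powi (- n)) ^ m"
  using twist_succ[OF assms, of m "n - 1"] assms
  by (simp add: power_divide power_mult_distrib power_int_minus field_simps)

lemma quasiperiodic_shift:
  assumes F: "\<And>z. z \<noteq> 0 \<Longrightarrow> F (z * q) = c * z ^ m * F z"
    and "c \<noteq> 0" "u \<noteq> 0"
  shows "F (u * q powi (- n)) = F u * twist c m u n"
proof (induction n rule: int_induct[where k = 0])
  case base
  show ?case by simp
next
  case (step1 i)
  define v where "v = u * q powi (- (i + 1))"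
  have v: "v \<noteq> 0" using assms by (simp add: v_def)
  have "v * q = u * q powi (- i)"
  proof -
    have "q powi (- i) = q powi (- (i + 1) + 1)" by simp
    also have "\<dots> = q powi (- (i + 1)) * q" by (subst power_int_add) simp_all
    finally show ?thesis by (simp add: v_def)
  qed
  hence "c * v ^ m * F v = F u * twist c m u i" using F[OF v] step1 by simp
  moreover have "v = 1 / (q powi (i + 1) / u)"
    unfolding v_def power_int_minus by (simp add: divide_simps)
  hence "v ^ m = 1 / (q powi (i + 1) / u) ^ m" by (metis power_one_over)
  moreover have "(q powi (i + 1) / u) ^ m \<noteq> 0" using assms by simp
  ultimately have "F v = F u * twist c m u i * (q powi (i + 1) / u) ^ m / c"
    using assms by (simp add: field_simps)
  thus ?case by (simp add: twist_succ assms v_def)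
next
  case (step2 i)
  define v where "v = u * q powi (- i)"
  have v: "v \<noteq> 0" using assms by (simp add: v_def)
  have "u * q powi (- (i - 1)) = v * q"
  proof -
    have "q powi (- (i - 1)) = q powi (- i + 1)" by simp
    also have "\<dots> = q powi (- i) * q" by (subst power_int_add) simp_all
    finally show ?thesis by (simp add: v_def)
  qed
  with F[OF v] step2 show ?case
    by (simp add: twist_pred assms v_def mult_ac)
qed

section \<open>Summability of the bilateral series and decay of the circle integrals\<close>

lemma tendsto_q_power: "(\<lambda>n. q ^ n) \<longlonglongrightarrow> 0"
  using q_less by (rule LIMSEQ_power_zero)

lemma tendsto_mult_q_power_power:
  "(\<lambda>n. (u * q ^ n) ^ m) \<longlonglongrightarrow> (if m = 0 then 1 else 0)"
proof (cases "m = 0")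
  case False
  have "(\<lambda>n. (u * q ^ n) ^ m) \<longlonglongrightarrow> (u * 0) ^ m"
    by (intro tendsto_intros tendsto_q_power)
  with False show ?thesis by (simp add: power_0_left)
qed auto

text \<open>Ratio test on each half. For m > 0 both ratios tend to 0; for m = 0 they tend to 1/c and
  c q^2, the latter of modulus below 1 because |c| |q| < 1 and |q| < 1.\<close>

lemma summable_twist:
  assumes "c \<noteq> 0" "u \<noteq> 0" "b \<noteq> 0" and b: "\<And>n::int. b * q powi n \<noteq> 1"
    and growth: "m > 0 \<or> norm q < 1 / norm c \<and> 1 / norm c < 1"
  shows "(\<lambda>n. twist c m u n / (1 - b * q powi n)\<^sup>2) summable_on UNIV"
proof (rule summable_on_int_from_halves)
  define f where "f = (\<lambda>n. twist c m u n / (1 - b * q powi n)\<^sup>2)"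
  have nz: "1 - b * q powi n \<noteq> 0" for n using b[of n] by auto
  have nz': "1 - b * q ^ n \<noteq> 0" for n using nz[of "int n"] by simp
  show "summable (\<lambda>n. norm (f (int n)))"
  proof (rule summable_norm_ratio_limit)
    define g where "g = (\<lambda>n. (q / u * q ^ n) ^ m / c * ((1 - b * q ^ n) / (1 - b * q ^ Suc n))\<^sup>2)"
    show "f (int (Suc n)) = f (int n) * g n" for n
    proof -
      have "twist c m u (int (Suc n)) = twist c m u (int n) * (q / u * q ^ n) ^ m / c"
        using twist_succ[OF assms(1,2), of m "int n"] by (simp add: power_int_add add.commute)
      moreover have "q powi int (Suc n) = q ^ Suc n" by (rule power_int_of_nat)
      ultimately show ?thesis unfolding f_def g_def
        using nz'[of n] by (simp only: power_int_of_nat) (simp add: power_divide)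
    qed
    show "g \<longlonglongrightarrow> (if m = 0 then 1 else 0) / c * ((1 - b * 0) / (1 - b * 0))\<^sup>2"
      unfolding g_def
      by (intro tendsto_intros tendsto_mult_q_power_power tendsto_q_power LIMSEQ_Suc[OF tendsto_q_power]) (use assms in auto)
    show "norm ((if m = 0 then 1 else 0) / c * ((1 - b * 0) / (1 - b * 0))\<^sup>2) < 1"
      using growth by (auto simp: norm_divide)
  qed
  show "summable (\<lambda>n. norm (f (- int n)))"
  proof (rule summable_norm_ratio_limit)
    \<comment> \<open>For negative indices the denominator is rewritten as 1 - b q^(-n) = (q^n -
      b)/q^n, whose numerator tends to -b \<noteq> 0; the ratio of the squared denominators then
      contributes q^2.\<close>
    define g where "g = (\<lambda>n. c * (u * q ^ n) ^ m * (q * ((q ^ n - b) / (q ^ Suc n - b)))\<^sup>2)"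
    show "f (- int (Suc n)) = f (- int n) * g n" for n
    proof -
      have tw: "twist c m u (- int (Suc n)) = twist c m u (- int n) * (c * (u * q ^ n) ^ m)"
        using twist_pred[OF assms(1,2), of m "- int n"]
        by (metis (no_types, lifting) add.inverse_inverse diff_conv_add_uminus minus_add_distrib
              mult.assoc of_nat_Suc power_int_of_nat uminus_add_conv_diff add.commute)
      have d: "1 - b * q powi (- int n) = (q ^ n - b) / q ^ n" for n
        by (simp add: power_int_minus field_simps)
      have nzd: "q ^ n - b \<noteq> 0" for n using nz[of "- int n"] unfolding d by auto
      define X Y where "X = q ^ n - b" and "Y = q ^ Suc n - b"
      have "X \<noteq> 0" "Y \<noteq> 0" unfolding X_def Y_def by (rule nzd)+
      thus ?thesis unfolding f_def g_def tw d X_def[symmetric] Y_def[symmetric]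
        by (simp add: power_divide power_mult_distrib field_simps)
    qed
    show "g \<longlonglongrightarrow> c * (if m = 0 then 1 else 0) * (q * ((0 - b) / (0 - b)))\<^sup>2"
      unfolding g_def
      by (intro tendsto_intros tendsto_mult_q_power_power tendsto_q_power LIMSEQ_Suc[OF tendsto_q_power])
         (use assms in auto)
    show "norm (c * (if m = 0 then 1 else 0) * (q * ((0 - b) / (0 - b)))\<^sup>2) < 1"
    proof (cases "m = 0")
      case True
      with growth have "norm c * norm q < 1" using assms(1) by (auto simp: field_simps)
      hence "norm c * norm q * norm q < 1 * 1"
        by (intro mult_strict_mono) (use q_less in auto)
      with True assms show ?thesis by (simp add: norm_mult power2_eq_square mult_ac)
    qed auto
  qed
qed

text \<open>On |w| = x the kernel is at most x/(x-1)^2 and the circumference is 2 pi x, so what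
  matters is the maximum of |F| times (x/(x-1))^2. The last factor is of order |q|^(2N) on the inner
  circles and merely bounded on the outer ones.\<close>

lemma circle_integrals_vanish:
  assumes F: "\<And>z. z \<noteq> 0 \<Longrightarrow> F (z * q) = c * z ^ m * F z"
    and "c \<noteq> 0" and \<rho>: "norm q < \<rho>" "\<rho> < 1" and cont: "continuous_on (sphere 0 \<rho>) F"
    and growth: "m > 0 \<or> norm q < 1 / norm c \<and> 1 / norm c < 1"
  shows "(\<lambda>N. contour_integral (circlepath 0 (\<rho> * norm q ^ N)) (\<lambda>w. F w * w / (w - 1)\<^sup>2)) \<longlonglongrightarrow> 0"
    and "(\<lambda>N. contour_integral (circlepath 0 (\<rho> / norm q ^ N)) (\<lambda>w. F w * w / (w - 1)\<^sup>2)) \<longlonglongrightarrow> 0"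
proof -
  define Q where "Q = norm q"
  have Q: "0 < Q" "Q < 1" using q_pos q_less by (auto simp: Q_def)
  have \<rho>0: "\<rho> > 0" "Q < \<rho>" using Q \<rho> unfolding Q_def by linarith+
  have Qlim: "(\<lambda>N. Q ^ N) \<longlonglongrightarrow> 0" by (rule LIMSEQ_power_zero) (use Q in auto)
  have Qm: "(\<lambda>N. (x * Q ^ N) ^ m) \<longlonglongrightarrow> (if m = 0 then 1 else 0)" for x :: real
  proof (cases "m = 0")
    case False
    have "(\<lambda>n. (x * Q ^ n) ^ m) \<longlonglongrightarrow> (x * 0) ^ m"
      by (intro tendsto_intros Qlim)
    with False show ?thesis by (simp add: power_0_left)
  qed auto
  have "bounded (F ` sphere 0 \<rho>)"
    by (intro compact_imp_bounded compact_continuous_image cont) auto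
  then obtain M where M: "\<And>w. norm w = \<rho> \<Longrightarrow> norm (F w) \<le> M"
    unfolding bounded_iff by fastforce
  have M0: "M \<ge> 0" using M[of "of_real \<rho>"] \<rho>0 by (simp add: order_trans[OF norm_ge_zero])
  have kernel: "norm (w / (w - 1)\<^sup>2) \<le> x / (x - 1)\<^sup>2" if "norm w = x" "x \<noteq> 1" for w :: complex and x :: real
  proof -
    have "\<bar>x - 1\<bar> \<le> norm (w - 1)" using norm_triangle_ineq3[of w 1] that by simp
    hence "\<bar>x - 1\<bar>\<^sup>2 \<le> (norm (w - 1))\<^sup>2" by (intro power_mono) auto
    hence "(x - 1)\<^sup>2 \<le> (norm (w - 1))\<^sup>2" by simp
    moreover have "x \<ge> 0" using that(1) by auto
    moreover have "w \<noteq> 1" using that by auto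
    ultimately show ?thesis
      using that by (auto simp: norm_divide norm_power intro!: divide_left_mono mult_pos_pos)
  qed
  have bound: "norm (contour_integral (circlepath 0 x) (\<lambda>w. F w * w / (w - 1)\<^sup>2))
      \<le> B * (2 * pi * (x / (x - 1))\<^sup>2)"
    if "x > 0" "x \<noteq> 1" "B \<ge> 0" "\<And>w. norm w = x \<Longrightarrow> norm (F w) \<le> B" for x B
  proof -
    have "norm (contour_integral (circlepath 0 x) (\<lambda>w. F w * w / (w - 1)\<^sup>2)) \<le> B * (x / (x - 1)\<^sup>2) * (2 * pi * x)"
    proof (rule norm_contour_integral_circlepath_le)
      fix w :: complex assume w: "norm w = x"
      have "norm (F w * (w / (w - 1)\<^sup>2)) \<le> B * (x / (x - 1)\<^sup>2)"
        unfolding norm_mult by (intro mult_mono that(4) kernel w that) (use that in auto)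
      thus "norm (F w * w / (w - 1)\<^sup>2) \<le> B * (x / (x - 1)\<^sup>2)" by simp
    qed (use that in auto)
    thus ?thesis by (simp add: power_divide power2_eq_square mult_ac)
  qed
  show "(\<lambda>N. contour_integral (circlepath 0 (\<rho> * norm q ^ N)) (\<lambda>w. F w * w / (w - 1)\<^sup>2)) \<longlonglongrightarrow> 0"
  proof -
    \<comment> \<open>The bound M on |w| = \<rho> carried inward: the step from radius \<rho> Q^i to
      the next multiplies |F| by |c| (\<rho> Q^i)^m.\<close>
    define U where "U = (\<lambda>N. M * (\<Prod>i<N. norm c * (\<rho> * Q ^ i) ^ m))"
    have U0: "U N \<ge> 0" for N unfolding U_def using M0 \<rho>0 Q by (intro mult_nonneg_nonneg prod_nonneg) auto
    have U: "norm (F w) \<le> U N" if "norm w = \<rho> * Q ^ N" for w N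
      using that
    proof (induction N arbitrary: w)
      case 0
      thus ?case using M by (simp add: U_def)
    next
      case (Suc N)
      define z where "z = w / q"
      have z: "norm z = \<rho> * Q ^ N" using Suc.prems Q by (simp add: z_def norm_divide Q_def)
      hence "z \<noteq> 0" using \<rho>0 Q by auto
      hence "F w = c * z ^ m * F z" using F[of z] by (simp add: z_def)
      hence "norm (F w) = norm c * (\<rho> * Q ^ N) ^ m * norm (F z)" by (simp add: norm_mult norm_power z)
      also have "\<dots> \<le> norm c * (\<rho> * Q ^ N) ^ m * U N"
        using Suc.IH[OF z] \<rho>0 Q by (intro mult_left_mono) auto
      finally show ?case by (simp add: U_def mult_ac)
    qed
    \<comment> \<open>Summability is used only to conclude that the terms tend to 0.\<close>
    have "summable (\<lambda>N. norm (U N * Q ^ (2 * N)))"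
    proof (rule summable_norm_ratio_limit)
      show "U (Suc n) * Q ^ (2 * Suc n) = U n * Q ^ (2 * n) * (norm c * (\<rho> * Q ^ n) ^ m * Q\<^sup>2)" for n
        by (simp add: U_def power2_eq_square mult_ac)
      show "(\<lambda>n. norm c * (\<rho> * Q ^ n) ^ m * Q\<^sup>2) \<longlonglongrightarrow> norm c * (if m = 0 then 1 else 0) * Q\<^sup>2"
        by (intro tendsto_intros Qm)
      show "norm (norm c * (if m = 0 then 1 else 0) * Q\<^sup>2) < 1"
      proof (cases "m = 0")
        case True
        with growth have "norm c * Q < 1" using assms(2) by (auto simp: field_simps Q_def)
        hence "norm c * Q * Q < 1 * 1"
          by (intro mult_strict_mono) (use Q in auto)
        moreover have "norm (norm c * (if m = 0 then 1 else 0) * Q\<^sup>2) = norm c * Q * Q"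
          using True Q by (simp add: power2_eq_square abs_mult)
        ultimately show ?thesis by linarith
      qed auto
    qed
    hence lim: "(\<lambda>N. U N * Q ^ (2 * N)) \<longlonglongrightarrow> 0"
      by (rule tendsto_norm_zero_cancel[OF summable_LIMSEQ_zero])
    have "(\<lambda>N. U N * Q ^ (2 * N) * (2 * pi * (\<rho> / (1 - \<rho>))\<^sup>2)) \<longlonglongrightarrow> 0"
      by (rule tendsto_mult_left_zero[OF lim])
    thus ?thesis
    proof (rule Lim_null_comparison[rotated], intro always_eventually allI)
      fix N
      define x where "x = \<rho> * Q ^ N"
      have x: "0 < x" "x \<le> \<rho>" using \<rho>0 Q by (auto simp: x_def mult_le_cancel_left1 power_le_one)
      have "x / (1 - x) \<le> x / (1 - \<rho>)" using x \<rho> by (intro divide_left_mono mult_pos_pos) auto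
      hence "(x / (1 - x))\<^sup>2 \<le> (x / (1 - \<rho>))\<^sup>2" using x \<rho> by (intro power_mono) auto
      moreover have "(x / (x - 1))\<^sup>2 = (x / (1 - x))\<^sup>2" by (simp add: power_divide power2_commute)
      moreover have "(x / (1 - \<rho>))\<^sup>2 = Q ^ (2 * N) * (\<rho> / (1 - \<rho>))\<^sup>2"
        by (simp add: x_def power_divide power_mult_distrib power_mult mult.commute[of 2])
      ultimately have le: "(x / (x - 1))\<^sup>2 \<le> Q ^ (2 * N) * (\<rho> / (1 - \<rho>))\<^sup>2" by simp
      have "norm (contour_integral (circlepath 0 x) (\<lambda>w. F w * w / (w - 1)\<^sup>2)) \<le> U N * (2 * pi * (x / (x - 1))\<^sup>2)"
        by (rule bound) (use x \<rho> U0 U in \<open>auto simp: x_def\<close>)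
      also have "\<dots> \<le> U N * (2 * pi * (Q ^ (2 * N) * (\<rho> / (1 - \<rho>))\<^sup>2))"
        by (intro mult_left_mono le) (use U0 in auto)
      finally show "norm (contour_integral (circlepath 0 (\<rho> * norm q ^ N)) (\<lambda>w. F w * w / (w - 1)\<^sup>2))
          \<le> U N * Q ^ (2 * N) * (2 * pi * (\<rho> / (1 - \<rho>))\<^sup>2)"
        by (simp add: x_def Q_def mult_ac)
    qed
  qed
  show "(\<lambda>N. contour_integral (circlepath 0 (\<rho> / norm q ^ N)) (\<lambda>w. F w * w / (w - 1)\<^sup>2)) \<longlonglongrightarrow> 0"
  proof -
    \<comment> \<open>Outward, the functional equation is solved for F w at |w| = \<rho> / Q^(i+1),
      where 1/|w| = (Q / \<rho>) Q^i.\<close>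
    define U where "U = (\<lambda>N. M * (\<Prod>i<N. (Q / \<rho> * Q ^ i) ^ m / norm c))"
    have U0: "U N \<ge> 0" for N unfolding U_def using M0 \<rho>0 Q by (intro mult_nonneg_nonneg prod_nonneg) auto
    have U: "norm (F w) \<le> U N" if "norm w = \<rho> / Q ^ N" for w N
      using that
    proof (induction N arbitrary: w)
      case 0
      thus ?case using M by (simp add: U_def)
    next
      case (Suc N)
      define z where "z = w * q"
      have z: "norm z = \<rho> / Q ^ N" using Suc.prems Q by (simp add: z_def norm_mult Q_def)
      have w: "w \<noteq> 0" using Suc.prems \<rho>0 Q by auto
      have "norm (F z) = norm c * norm w ^ m * norm (F w)"
        using F[OF w] by (simp add: z_def norm_mult norm_power)
      hence "norm (F w) = norm (F z) / (norm c * norm w ^ m)" using w assms(2) by simp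
      also have "\<dots> = (1 / norm w) ^ m / norm c * norm (F z)" by (simp add: power_one_over)
      also have "1 / norm w = Q / \<rho> * Q ^ N" using Suc.prems by simp
      also have "(Q / \<rho> * Q ^ N) ^ m / norm c * norm (F z) \<le> (Q / \<rho> * Q ^ N) ^ m / norm c * U N"
        using Suc.IH[OF z] \<rho>0 Q by (intro mult_left_mono) auto
      finally show ?case by (simp add: U_def mult_ac)
    qed
    have "summable (\<lambda>N. norm (U N))"
    proof (rule summable_norm_ratio_limit)
      show "U (Suc n) = U n * ((Q / \<rho> * Q ^ n) ^ m / norm c)" for n
        by (simp add: U_def)
      show "(\<lambda>n. (Q / \<rho> * Q ^ n) ^ m / norm c) \<longlonglongrightarrow> (if m = 0 then 1 else 0) / norm c"
        by (intro tendsto_intros Qm) (use assms(2) in auto)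
      show "norm ((if m = 0 then 1 else 0) / norm c) < 1"
        using growth by auto
    qed
    hence lim: "U \<longlonglongrightarrow> 0"
      by (rule tendsto_norm_zero_cancel[OF summable_LIMSEQ_zero])
    have "(\<lambda>N. U N * (2 * pi * (1 / (1 - Q / \<rho>))\<^sup>2)) \<longlonglongrightarrow> 0"
      by (rule tendsto_mult_left_zero[OF lim])
    thus ?thesis
    proof (rule Lim_null_comparison[rotated])
      \<comment> \<open>At N = 0 the radius is \<rho> < 1. From N = 1 on it is at least \<rho> / Q >
        1, which keeps x/(x-1) at most 1/(1 - Q/\<rho>).\<close>
      show "\<forall>\<^sub>F N in sequentially. norm (contour_integral (circlepath 0 (\<rho> / norm q ^ N)) (\<lambda>w. F w * w / (w - 1)\<^sup>2))
          \<le> U N * (2 * pi * (1 / (1 - Q / \<rho>))\<^sup>2)"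
        using eventually_ge_at_top[of 1]
      proof eventually_elim
        fix N :: nat assume N: "N \<ge> 1"
        define x where "x = \<rho> / Q ^ N"
        have "Q ^ N \<le> Q" using power_decreasing[OF N, of Q] Q by simp
        hence x1: "1 / x \<le> Q / \<rho>" using \<rho>0 Q by (simp add: x_def divide_right_mono)
        have x0: "0 < x" using \<rho>0 Q by (auto simp: x_def)
        have Q\<rho>: "Q / \<rho> < 1" using \<rho>0 by simp
        have "1 / x < 1" using x1 Q\<rho> by linarith
        hence x: "x > 1" using x0 by simp
        have "x / (x - 1) = 1 / (1 - 1 / x)" using x by (simp add: divide_simps)
        also have "\<dots> \<le> 1 / (1 - Q / \<rho>)" using x1 Q\<rho> by (intro divide_left_mono mult_pos_pos) auto
        finally have le: "(x / (x - 1))\<^sup>2 \<le> (1 / (1 - Q / \<rho>))\<^sup>2" using x by (intro power_mono) auto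
        have "norm (contour_integral (circlepath 0 x) (\<lambda>w. F w * w / (w - 1)\<^sup>2)) \<le> U N * (2 * pi * (x / (x - 1))\<^sup>2)"
          by (rule bound) (use x U0 U[of _ N, folded x_def] in auto)
        also have "\<dots> \<le> U N * (2 * pi * (1 / (1 - Q / \<rho>))\<^sup>2)"
          by (intro mult_left_mono le) (use U0 in auto)
        finally show "norm (contour_integral (circlepath 0 (\<rho> / norm q ^ N)) (\<lambda>w. F w * w / (w - 1)\<^sup>2))
            \<le> U N * (2 * pi * (1 / (1 - Q / \<rho>))\<^sup>2)"
          by (simp add: x_def Q_def)
      qed
    qed
  qed
qed

end

section \<open>Quotients of theta products\<close>

lemma finite_powi_between:
  fixes x y Q :: real
  assumes "0 < Q" "Q < 1" "0 < x" "0 < y"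
  shows "finite {n::int. x < Q powi (- n) \<and> Q powi (- n) < y}"
proof -
  obtain M where M: "Q ^ M < x" using real_arch_pow_inv[OF assms(3,2)] by blast
  obtain N where N: "Q ^ N < 1 / y" using real_arch_pow_inv[of "1 / y" Q] assms by auto
  have "{n::int. x < Q powi (- n) \<and> Q powi (- n) < y} \<subseteq> {- int M..int N}"
  proof
    fix n assume n: "n \<in> {n::int. x < Q powi (- n) \<and> Q powi (- n) < y}"
    have "- int M \<le> n"
    proof (rule ccontr)
      assume "\<not> - int M \<le> n"
      then obtain k where k: "n = - int k" "M \<le> k"
        by (metis le_minus_iff linorder_le_cases neg_0_le_iff_le nonneg_int_cases of_nat_0_le_iff
              of_nat_le_iff order_trans minus_minus)
      have "Q powi (- n) \<le> Q ^ M" using k assms by (simp add: power_decreasing)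
      with M n show False by simp
    qed
    moreover have "n \<le> int N"
    proof (rule ccontr)
      assume "\<not> n \<le> int N"
      then obtain k where k: "n = int k" "N \<le> k"
        by (metis linorder_le_cases nonneg_int_cases of_nat_0_le_iff of_nat_le_iff order_trans)
      have "Q ^ k \<le> Q ^ N" using k assms by (simp add: power_decreasing)
      hence "Q ^ k < 1 / y" using N by simp
      hence "y < 1 / Q ^ k" using assms by (simp add: field_simps)
      with k n show False by (simp add: power_int_minus inverse_eq_divide)
    qed
    ultimately show "n \<in> {- int M..int N}" by simp
  qed
  thus ?thesis by (rule finite_subset) simp
qed

context nome
begin

lemma tendsto_qpoch [tendsto_intros]:
  assumes "(f \<longlongrightarrow> l) F"
  shows "((\<lambda>x. qpoch_inf (f x) q) \<longlongrightarrow> qpoch_inf l q) F"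
  by (rule isCont_tendsto_compose[OF DERIV_isCont[OF has_field_derivative_qpoch] assms])

lemma tendsto_qbracket [tendsto_intros]:
  assumes "(f \<longlongrightarrow> l) F" "l \<noteq> 0"
  shows "((\<lambda>x. qbracket q (f x)) \<longlongrightarrow> qbracket q l) F"
  unfolding qbracket_def by (intro tendsto_intros assms)

lemma q_powi_inject: "q powi m = q powi n \<longleftrightarrow> m = n"
proof
  assume "q powi m = q powi n"
  hence "norm q powi m = norm q powi n" by (metis norm_power_int)
  thus "m = n" using q_pos q_less power_int_strict_decreasing[of _ _ "norm q"]
    by (metis linorder_neqE order_less_irrefl)
qed simp

end

text \<open>Writing s as \<open>r + m\<close> makes the exponent s - r a natural number.
  \<open>b_distinct\<close> says that no b_j/b_k with j \<noteq> k is a power of q, so the poles are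
  simple; \<open>b_neq_1\<close> keeps them away from the double pole at 1.\<close>

locale theta_quotient = nome +
  fixes r m :: nat and a b :: "nat \<Rightarrow> complex"
  assumes a_nz: "\<And>i. i \<in> {1..r} \<Longrightarrow> a i \<noteq> 0"
    and b_nz: "\<And>k. k \<in> {1..r + m} \<Longrightarrow> b k \<noteq> 0"
    and b_distinct: "\<And>k j. k \<in> {1..r + m} \<Longrightarrow> j \<in> {1..r + m} \<Longrightarrow> j \<noteq> k \<Longrightarrow> qbracket q (b j / b k) \<noteq> 0"
    and b_neq_1: "\<And>k n. k \<in> {1..r + m} \<Longrightarrow> b k * q powi n \<noteq> 1"
    and growth: "m > 0 \<or> norm q < norm ((\<Prod>i=1..r. a i) / (\<Prod>k=1..r + m. b k))
                \<and> norm ((\<Prod>i=1..r. a i) / (\<Prod>k=1..r + m. b k)) < 1"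
begin

definition multiplier :: complex where
  "multiplier = (-1) ^ m * (\<Prod>k=1..r + m. b k) / (\<Prod>i=1..r. a i)"

definition F :: "complex \<Rightarrow> complex" where
  "F w = (qpoch_inf q q)\<^sup>2 * (\<Prod>i=1..r. qbracket q (a i * w)) / (\<Prod>k=1..r + m. qbracket q (b k * w))"

definition pole :: "nat \<Rightarrow> int \<Rightarrow> complex" where
  "pole k n = q powi (- n) / b k"

text \<open>The value at 1/b_k of the quotient \<open>F\<close> stripped of the factor 1 - b_k w;
  both factors (q;q)^2 have cancelled.\<close>

definition pole_coeff :: "nat \<Rightarrow> complex" where
  "pole_coeff k = (\<Prod>i=1..r. qbracket q (a i / b k)) / (\<Prod>j\<in>{1..r + m} - {k}. qbracket q (b j / b k))"

lemma multiplier_nz: "multiplier \<noteq> 0"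
  using a_nz b_nz by (auto simp: multiplier_def)

lemma growth_mult: "m > 0 \<or> norm q < 1 / norm multiplier \<and> 1 / norm multiplier < 1"
  using growth by (auto simp: multiplier_def norm_divide norm_mult norm_power)

lemma pole_nz: "k \<in> {1..r + m} \<Longrightarrow> pole k n \<noteq> 0"
  using b_nz by (simp add: pole_def)

lemma F_mult_q:
  assumes "z \<noteq> 0"
  shows "F (z * q) = multiplier * z ^ m * F z"
proof -
  have *: "(\<Prod>i\<in>I. qbracket q (x i * (z * q))) = (-1) ^ card I * (\<Prod>i\<in>I. qbracket q (x i * z)) / ((\<Prod>i\<in>I. x i) * z ^ card I)"
    if "\<And>i. i \<in> I \<Longrightarrow> x i \<noteq> 0" for x and I :: "nat set"
  proof -
    have "(\<Prod>i\<in>I. qbracket q (x i * (z * q))) = (\<Prod>i\<in>I. (-1) * qbracket q (x i * z) / (x i * z))"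
      by (rule prod.cong) (use that assms qbracket_mult_q in \<open>auto simp: mult.assoc[symmetric]\<close>)
    thus ?thesis by (simp only: prod_dividef prod.distrib prod_constant)
  qed
  have A: "(\<Prod>i=1..r. a i) \<noteq> 0" and B: "(\<Prod>k=1..r + m. b k) \<noteq> 0" using a_nz b_nz by auto
  have num: "(\<Prod>i=1..r. qbracket q (a i * (z * q)))
      = (-1) ^ r * (\<Prod>i=1..r. qbracket q (a i * z)) / ((\<Prod>i=1..r. a i) * z ^ r)"
    using *[of "{1..r}" a] a_nz by simp
  have denom: "(\<Prod>k=1..r + m. qbracket q (b k * (z * q)))
      = (-1) ^ (r + m) * (\<Prod>k=1..r + m. qbracket q (b k * z)) / ((\<Prod>k=1..r + m. b k) * z ^ (r + m))"
    using *[of "{1..r + m}" b] b_nz by simp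
  \<comment> \<open>Here \<open>s\<close> and \<open>e\<close> stand for (-1)^r and (-1)^m, so
    \<open>e\<close> is its own inverse. \<open>Nb\<close> may be 0: then both sides are 0 by the
    convention x/0 = 0, and the functional equation holds at the poles as well.\<close>
  have alg: "K * (s * Na / (A * Z)) / (s * e * Nb / (B * (Z * Y))) = e * B / A * Y * (K * Na / Nb)"
    if "e = 1 \<or> e = -1" "s \<noteq> 0" "Z \<noteq> 0" "A \<noteq> 0" "B \<noteq> 0" for K s Na A Z e Nb B Y :: complex
    using that by (auto simp: field_simps)
  show ?thesis
    unfolding F_def multiplier_def num denom power_add
    by (rule alg) (use A B assms in \<open>auto simp: minus_one_power_iff\<close>)
qed

lemma F_shift:
  assumes "u \<noteq> 0"
  shows "F (u * q powi (- n)) = F u * twist multiplier m u n"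
  by (rule quasiperiodic_shift[OF F_mult_q multiplier_nz assms])

section \<open>Location of the poles and their residues\<close>

lemma qbracket_b_eq_0_iff:
  assumes "k \<in> {1..r + m}" "w \<noteq> 0"
  shows "qbracket q (b k * w) = 0 \<longleftrightarrow> (\<exists>n. w = pole k n)"
proof -
  have "b k * w * q powi n = 1 \<longleftrightarrow> w = pole k n" for n
    using b_nz[OF assms(1)] by (auto simp: pole_def power_int_minus field_simps)
  thus ?thesis using assms b_nz by (simp add: qbracket_eq_0_iff)
qed

text \<open>Coinciding poles would make b_j/b_k a power of q, hence a zero of the bracket. This
  allows sums over poles to be indexed by pairs (k, n).\<close>

lemma pole_inject:
  assumes "k \<in> {1..r + m}" "j \<in> {1..r + m}" "pole k n = pole j l"
  shows "k = j" "n = l"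
proof -
  have eq: "b j / b k = q powi (n - l)"
    using assms b_nz by (auto simp: pole_def power_int_minus power_int_diff field_simps)
  show "k = j"
  proof (rule ccontr)
    assume "k \<noteq> j"
    hence "qbracket q (b j / b k) \<noteq> 0" using b_distinct assms by auto
    hence "b j / b k * q powi (l - n) \<noteq> 1"
      using assms b_nz by (subst (asm) qbracket_eq_0_iff) auto
    thus False unfolding eq by (simp add: power_int_diff)
  qed
  hence "q powi (n - l) = q powi 0" using eq b_nz[OF assms(1)] by simp
  thus "n = l" by (simp only: q_powi_inject)
qed

lemma pole_neq_1: "k \<in> {1..r + m} \<Longrightarrow> pole k n \<noteq> 1"
  using b_neq_1[of k n] b_nz[of k] by (auto simp: pole_def power_int_minus field_simps)

lemma holomorphic_F:
  assumes "\<And>w. w \<in> S \<Longrightarrow> w \<noteq> 0" "\<And>w k n. w \<in> S \<Longrightarrow> k \<in> {1..r + m} \<Longrightarrow> w \<noteq> pole k n"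
  shows "F holomorphic_on S"
  unfolding F_def
proof (intro holomorphic_intros)
  show "(\<Prod>k=1..r + m. qbracket q (b k * w)) \<noteq> 0" if "w \<in> S" for w
    using qbracket_b_eq_0_iff assms that by fastforce
qed (use assms a_nz b_nz in auto)

text \<open>No second bracket of the denominator vanishes at this point, so the residue is the limit
  of the function times w - p. A numerator vanishing there is covered too: both sides are then
  0.\<close>

lemma residue_pole:
  assumes k: "k \<in> {1..r + m}" and S: "open S" "pole k n \<in> S" "0 \<notin> S" "1 \<notin> S"
    and other: "\<And>j l. j \<in> {1..r + m} \<Longrightarrow> pole j l \<in> S \<Longrightarrow> pole j l = pole k n"
  shows "residue (\<lambda>w. F w * w / (w - 1)\<^sup>2) (pole k n)
           = - pole_coeff k * (twist multiplier m (1 / b k) n / (1 - b k * q powi n)\<^sup>2)"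
proof (rule residue_simple'[OF S(1,2)])
  let ?p = "pole k n"
  show "(\<lambda>w. F w * w / (w - 1)\<^sup>2) holomorphic_on S - {?p}"
    by (intro holomorphic_intros holomorphic_F) (use S other in auto)
  have bk: "b k \<noteq> 0" using b_nz k by blast
  define u where "u = (\<lambda>w. w * q powi n)"
  have u_p: "u ?p = 1 / b k" by (simp add: u_def pole_def power_int_minus)
  have u_lim: "(u \<longlongrightarrow> 1 / b k) (at ?p)"
    unfolding u_p[symmetric] u_def by (intro tendsto_intros)
  \<comment> \<open>By the shift formula it suffices to treat the pole at \<open>1 / b k\<close>, where the vanishing factor is explicit.\<close>
  define G where "G = (\<lambda>v. (qpoch_inf q q)\<^sup>2 * (\<Prod>i=1..r. qbracket q (a i * v)) /
      ((\<Prod>j\<in>{1..r + m} - {k}. qbracket q (b j * v)) * (qpoch_inf (b k * v * q) q * qpoch_inf (q / (b k * v)) q)))"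
  have F_G: "F v = G v / (1 - b k * v)" for v
  proof -
    have split: "(\<Prod>j=1..r + m. qbracket q (b j * v)) = qbracket q (b k * v) * (\<Prod>j\<in>{1..r + m} - {k}. qbracket q (b j * v))"
      using k by (simp add: prod.remove)
    show ?thesis
      unfolding F_def G_def split qbracket_factor[of "b k * v"] by (simp add: mult_ac)
  qed
  have qq: "qpoch_inf q q \<noteq> 0"
    using q_powi_inject[of "int (Suc _)" 0] by (auto simp: qpoch_eq_0_iff simp del: of_nat_Suc)
  have prod_nz: "(\<Prod>j\<in>{1..r + m} - {k}. qbracket q (b j * (1 / b k))) \<noteq> 0"
    using b_distinct k by auto
  have G_val: "G (1 / b k) = pole_coeff k"
    unfolding G_def pole_coeff_def using qq bk by (simp add: power2_eq_square)
  have G_lim: "((\<lambda>w. G (u w)) \<longlongrightarrow> G (1 / b k)) (at ?p)"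
    unfolding G_def
    by (intro tendsto_intros u_lim) (use prod_nz qq bk a_nz b_nz in auto)
  \<comment> \<open>The function times w - p with the vanishing factor cancelled; its limit can be
    read off by continuity.\<close>
  define R where "R = (\<lambda>w. - ?p * G (u w) * twist multiplier m (u w) n * w / (w - 1)\<^sup>2)"
  have "(R \<longlongrightarrow> - ?p * G (1 / b k) * twist multiplier m (1 / b k) n * ?p / (?p - 1)\<^sup>2) (at ?p)"
    unfolding R_def twist_def
    by (intro tendsto_intros G_lim u_lim) (use bk pole_neq_1[OF k] in auto)
  also have "?this \<longleftrightarrow> ((\<lambda>w. F w * w / (w - 1)\<^sup>2 * (w - ?p)) \<longlongrightarrow>
      - ?p * G (1 / b k) * twist multiplier m (1 / b k) n * ?p / (?p - 1)\<^sup>2) (at ?p)"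
  proof (rule tendsto_cong)
    have "eventually (\<lambda>w. w \<in> S - {?p}) (at ?p)"
      using S by (intro eventually_at_in_open) auto
    thus "\<forall>\<^sub>F w in at ?p. R w = F w * w / (w - 1)\<^sup>2 * (w - ?p)"
    proof eventually_elim
      case (elim w)
      have w: "w \<noteq> 0" "w \<noteq> ?p" using S elim by auto
      have uw: "u w * q powi (- n) = w" by (simp add: u_def power_int_minus)
      have "u w \<noteq> 0" using w by (simp add: u_def)
      hence "F w = F (u w) * twist multiplier m (u w) n" using F_shift[of "u w" n] by (simp add: uw)
      \<comment> \<open>The minus sign in this factorization is why the series appears with opposite
        sign.\<close>
      moreover have "w - ?p = - ?p * (1 - b k * u w)"
        using bk by (simp add: pole_def u_def power_int_minus field_simps)
      moreover have "1 - b k * u w \<noteq> 0"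
        using w calculation(2) by auto
      ultimately show ?case
        unfolding R_def F_G by simp
    qed
  qed
  finally have lim: "((\<lambda>w. F w * w / (w - 1)\<^sup>2 * (w - ?p)) \<longlongrightarrow>
      - ?p * G (1 / b k) * twist multiplier m (1 / b k) n * ?p / (?p - 1)\<^sup>2) (at ?p)" .
  have "?p * ?p / (?p - 1)\<^sup>2 = 1 / (1 - b k * q powi n)\<^sup>2"
  proof -
    have "?p - 1 = ?p * (1 - b k * q powi n)"
      using bk by (simp add: pole_def power_int_minus field_simps)
    thus ?thesis using pole_nz[OF k, of n] by (simp add: power_mult_distrib power2_eq_square)
  qed
  moreover have "- ?p * pole_coeff k * t * ?p / (?p - 1)\<^sup>2 = - pole_coeff k * t * (?p * ?p / (?p - 1)\<^sup>2)" for t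
    by simp
  ultimately have "- ?p * pole_coeff k * t * ?p / (?p - 1)\<^sup>2 = - pole_coeff k * (t / (1 - b k * q powi n)\<^sup>2)" for t
    by simp
  with G_val have "- ?p * G (1 / b k) * twist multiplier m (1 / b k) n * ?p / (?p - 1)\<^sup>2
    = - pole_coeff k * (twist multiplier m (1 / b k) n / (1 - b k * q powi n)\<^sup>2)" by simp
  with lim show "((\<lambda>w. F w * w / (w - 1)\<^sup>2 * (w - ?p)) \<longlongrightarrow>
      - pole_coeff k * (twist multiplier m (1 / b k) n / (1 - b k * q powi n)\<^sup>2)) (at ?p)" by simp
qed

text \<open>Logarithmic differentiation: the numerator gives -S(a), the denominator S(b), and the
  factor w of the kernel gives the summand 1.\<close>

lemma residue_1:
  assumes a: "\<And>i. i \<in> {1..r} \<Longrightarrow> qbracket q (a i) \<noteq> 0"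
    and S: "open S" "1 \<in> S" "0 \<notin> S" "\<And>k n. k \<in> {1..r + m} \<Longrightarrow> pole k n \<notin> S"
  shows "residue (\<lambda>w. F w * w / (w - 1)\<^sup>2) 1 = F 1 * (1 - qS q r a + qS q (r + m) b)"
proof -
  have b: "qbracket q (b k) \<noteq> 0" if "k \<in> {1..r + m}" for k
    using that qbracket_b_eq_0_iff[of k 1] pole_neq_1[of k] by fastforce
  define sa where "sa = (\<lambda>z. \<Sum>n. 1 / (1 - z * q ^ n) - 1 / (1 - inverse z * q ^ (n + 1)))"
  have deriv_prod: "((\<lambda>w. \<Prod>i\<in>I. qbracket q (x i * w)) has_field_derivative
      (\<Prod>i\<in>I. qbracket q (x i)) * (- (\<Sum>i\<in>I. sa (x i)))) (at 1)"
    if "\<And>i. i \<in> I \<Longrightarrow> x i \<noteq> 0 \<and> qbracket q (x i) \<noteq> 0" for x and I :: "nat set"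
  proof -
    have "((\<lambda>w. \<Prod>i\<in>I. qbracket q (x i * w)) has_field_derivative
      (\<Prod>i\<in>I. qbracket q (x i * 1)) * (\<Sum>i\<in>I. - qbracket q (x i) * sa (x i) / qbracket q (x i * 1))) (at 1)"
      by (rule has_field_derivative_prod') (use that logderiv_qbracket in \<open>auto simp: sa_def\<close>)
    also have "(\<Sum>i\<in>I. - qbracket q (x i) * sa (x i) / qbracket q (x i * 1)) = - (\<Sum>i\<in>I. sa (x i))"
      unfolding sum_negf[symmetric] by (rule sum.cong) (use that in auto)
    finally show ?thesis by simp
  qed
  have holo: "(\<lambda>w. F w * w) holomorphic_on S"
    by (intro holomorphic_intros holomorphic_F) (use S in auto)
  have "residue (\<lambda>w. F w * w / (w - 1) ^ Suc 1) 1 = deriv (\<lambda>w. F w * w) 1"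
    using residue_holomorphic_over_power[OF S(1,2) holo, of 1] by simp
  also have "deriv (\<lambda>w. F w * w) 1 = F 1 * (1 - qS q r a + qS q (r + m) b)"
  proof (rule DERIV_imp_deriv)
    define N D where "N = (\<Prod>i=1..r. qbracket q (a i))" and "D = (\<Prod>k=1..r + m. qbracket q (b k))"
    have D: "D \<noteq> 0" using b by (auto simp: D_def)
    have F1: "F 1 = (qpoch_inf q q)\<^sup>2 * N / D" by (simp add: F_def N_def D_def)
    have "(F has_field_derivative
        (((qpoch_inf q q)\<^sup>2 * (N * (- qS q r a))) * D - (qpoch_inf q q)\<^sup>2 * N * (D * (- qS q (r + m) b))) / (D * D)) (at 1)"
    proof -
      have 1: "((\<lambda>w. (qpoch_inf q q)\<^sup>2 * (\<Prod>i=1..r. qbracket q (a i * w))) has_field_derivative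
          (qpoch_inf q q)\<^sup>2 * (N * (- qS q r a))) (at 1)"
        unfolding N_def qS_def
        by (intro DERIV_cmult deriv_prod[unfolded sa_def]) (use a a_nz in auto)
      have 2: "((\<lambda>w. \<Prod>k=1..r + m. qbracket q (b k * w)) has_field_derivative D * (- qS q (r + m) b)) (at 1)"
        unfolding D_def qS_def
        by (intro deriv_prod[unfolded sa_def]) (use b b_nz in auto)
      have "(\<Prod>k=1..r + m. qbracket q (b k * 1)) \<noteq> 0" using D by (simp add: D_def)
      from DERIV_divide[OF 1 2 this] show ?thesis
        unfolding F_def[abs_def] by (simp only: mult_1_right N_def D_def)
    qed
    hence "(F has_field_derivative F 1 * (- qS q r a + qS q (r + m) b)) (at 1)"
      by (rule DERIV_cong) (use D in \<open>simp add: F1 field_simps\<close>)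
    from DERIV_mult[OF this DERIV_ident] show "((\<lambda>w. F w * w) has_field_derivative F 1 * (1 - qS q r a + qS q (r + m) b)) (at 1)"
      by (rule DERIV_cong) (simp add: algebra_simps)
  qed
  finally show ?thesis by (simp add: numeral_2_eq_2)
qed

section \<open>Summation over annuli and passage to the limit\<close>

lemma finite_poles_between:
  assumes "k \<in> {1..r + m}" "0 < x" "0 < y"
  shows "finite {n. x < norm (pole k n) \<and> norm (pole k n) < y}"
proof -
  have bk: "norm (b k) > 0" using b_nz assms(1) by simp
  have "{n. x < norm (pole k n) \<and> norm (pole k n) < y}
      = {n. x * norm (b k) < norm q powi (- n) \<and> norm q powi (- n) < y * norm (b k)}"
    using bk unfolding pole_def norm_divide norm_power_int
    by (simp add: pos_less_divide_eq pos_divide_less_eq)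
  also have "finite \<dots>"
    by (rule finite_powi_between) (use q_pos q_less assms bk in auto)
  finally show ?thesis .
qed

text \<open>The moduli of the poles are countable, the interval is not. These moduli are invariant
  under powers of |q|, so avoiding them on one circle avoids them on the whole family.\<close>

lemma circle_avoiding_poles:
  obtains \<rho> where "norm q < \<rho>" "\<rho> < 1"
    "\<And>k n N. k \<in> {1..r + m} \<Longrightarrow> norm (pole k n) \<noteq> \<rho> * norm q powi N"
proof -
  define bad where "bad = (\<lambda>(k, n). norm (pole k n)) ` ({1..r + m} \<times> UNIV)"
  have "countable bad" unfolding bad_def by (intro countable_image countable_SIGMA) auto
  hence "uncountable ({norm q<..<1} - bad)"
    using q_less by (intro uncountable_minus_countable) (auto simp: uncountable_open_interval)
  then obtain \<rho> where \<rho>: "\<rho> \<in> {norm q<..<1} - bad" by (metis all_not_in_conv countable_empty)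
  have "norm (pole k n) \<noteq> \<rho> * norm q powi N" if k: "k \<in> {1..r + m}" for k n N
  proof
    assume eq: "norm (pole k n) = \<rho> * norm q powi N"
    have "pole k (n + N) = pole k n * q powi (- N)"
      using power_int_add[of q "- n" "- N"] by (simp add: pole_def)
    hence "norm (pole k (n + N)) = \<rho>"
      using eq by (simp add: norm_mult norm_power_int power_int_minus norm_inverse)
    hence "\<rho> \<in> bad" using k by (force simp: bad_def)
    with \<rho> show False by simp
  qed
  with \<rho> that show ?thesis by auto
qed

lemma annulus_residues:
  assumes a: "\<And>i. i \<in> {1..r} \<Longrightarrow> qbracket q (a i) \<noteq> 0"
    and x: "0 < x" "x < 1" and y: "1 < y"
    and avoid: "\<And>k n. k \<in> {1..r + m} \<Longrightarrow> norm (pole k n) \<noteq> x \<and> norm (pole k n) \<noteq> y"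
  shows "contour_integral (circlepath 0 y) (\<lambda>w. F w * w / (w - 1)\<^sup>2)
       - contour_integral (circlepath 0 x) (\<lambda>w. F w * w / (w - 1)\<^sup>2)
     = 2 * pi * \<i> * (F 1 * (1 - qS q r a + qS q (r + m) b)
         - (\<Sum>k=1..r + m. pole_coeff k *
             (\<Sum>n | x < norm (pole k n) \<and> norm (pole k n) < y.
                twist multiplier m (1 / b k) n / (1 - b k * q powi n)\<^sup>2)))"
proof -
  let ?f = "\<lambda>w. F w * w / (w - 1)\<^sup>2"
  \<comment> \<open>A slightly larger open annulus: it contains the closed one, still omits 0, and
    still has finitely many poles.\<close>
  define S where "S = {w::complex. x / 2 < norm (w - 0) \<and> norm (w - 0) < 2 * y}"
  define E where "E = (\<lambda>u v. SIGMA k:{1..r + m}. {n. u < norm (pole k n) \<and> norm (pole k n) < v})"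
  define Z where "Z = (\<lambda>(k, n). pole k n) ` E (x / 2) (2 * y)"
  define pts where "pts = insert 1 Z"
  have fin: "finite (E u v)" if "0 < u" "0 < v" for u v
    unfolding E_def using that by (intro finite_SigmaI finite_poles_between) auto
  have fin_pts: "finite pts" unfolding pts_def Z_def using x y by (simp add: fin)
  have S: "open S" "connected S"
  proof -
    have "S = ball 0 (2 * y) - cball 0 (x / 2)" by (auto simp: S_def)
    thus "open S" by auto
    show "connected S" unfolding S_def by (rule connected_annulus) simp
  qed
  have S_Z: "pole k n \<in> Z" if "k \<in> {1..r + m}" "pole k n \<in> S" for k n
    using that by (force simp: Z_def E_def S_def)
  have Z_S: "Z \<subseteq> S" by (auto simp: Z_def E_def S_def)
  have Z_cases: "\<exists>k n. k \<in> {1..r + m} \<and> p = pole k n" if "p \<in> Z" for p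
    using that by (auto simp: Z_def E_def)
  have Z1: "1 \<notin> Z" using Z_cases pole_neq_1 by metis
  have S1: "1 \<in> S" "0 \<notin> S" using x y by (auto simp: S_def)
  have avoidZ: "norm p \<noteq> x \<and> norm p \<noteq> y" if "p \<in> Z" for p
    using Z_cases[OF that] avoid by auto
  have "contour_integral (circlepath 0 y) ?f - contour_integral (circlepath 0 x) ?f
    = 2 * pi * \<i> * (\<Sum>p\<in>{p\<in>pts. x < norm p \<and> norm p < y}. residue ?f p)"
  proof (rule annulus_residue_theorem[OF x(1) _ S])
    show "x < y" using x y by simp
    show "cball 0 y - ball 0 x \<subseteq> S" using x y by (auto simp: S_def)
    show "finite pts" by fact
    show "pts \<inter> sphere 0 x = {}" "pts \<inter> sphere 0 y = {}"
      using avoidZ x y by (auto simp: pts_def)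
    show "?f holomorphic_on S - pts"
      by (intro holomorphic_intros holomorphic_F) (use S1 S_Z in \<open>auto simp: pts_def\<close>)
  qed
  also have "{p\<in>pts. x < norm p \<and> norm p < y} = insert 1 ((\<lambda>(k, n). pole k n) ` E x y)"
  proof -
    have "{p\<in>Z. x < norm p \<and> norm p < y} = (\<lambda>(k, n). pole k n) ` E x y"
    proof -
      have "E x y = {kn \<in> E (x / 2) (2 * y). x < norm (pole (fst kn) (snd kn)) \<and> norm (pole (fst kn) (snd kn)) < y}"
        using x y by (auto simp: E_def)
      thus ?thesis by (auto simp: Z_def)
    qed
    thus ?thesis using x y by (auto simp: pts_def)
  qed
  also have "(\<Sum>p\<in>insert 1 ((\<lambda>(k, n). pole k n) ` E x y). residue ?f p)
      = residue ?f 1 + (\<Sum>p\<in>(\<lambda>(k, n). pole k n) ` E x y. residue ?f p)"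
  proof (rule sum.insert)
    show "finite ((\<lambda>(k, n). pole k n) ` E x y)" using fin x y by simp
    show "1 \<notin> (\<lambda>(k, n). pole k n) ` E x y"
      using pole_neq_1 by (auto simp: E_def image_iff)
  qed
  also have "residue ?f 1 = F 1 * (1 - qS q r a + qS q (r + m) b)"
  proof (rule residue_1[OF a])
    show "open (S - Z)" using S fin_pts by (intro open_Diff finite_imp_closed) (auto simp: pts_def)
    show "pole k n \<notin> S - Z" if "k \<in> {1..r + m}" for k n using S_Z that by blast
  qed (use S1 Z1 in auto)
  also have "(\<Sum>p\<in>(\<lambda>(k, n). pole k n) ` E x y. residue ?f p) = (\<Sum>(k, n)\<in>E x y. residue ?f (pole k n))"
  proof (subst sum.reindex)
    show "inj_on (\<lambda>(k, n). pole k n) (E x y)"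
      using pole_inject by (auto simp: inj_on_def E_def)
  qed (simp add: o_def case_prod_unfold)
  also have "\<dots> = (\<Sum>(k, n)\<in>E x y. - pole_coeff k *
      (twist multiplier m (1 / b k) n / (1 - b k * q powi n)\<^sup>2))"
  proof (intro sum.cong refl, clarify)
    fix k n assume kn: "(k, n) \<in> E x y"
    hence k: "k \<in> {1..r + m}" by (auto simp: E_def)
    have "pole k n \<in> S" using kn x y by (auto simp: E_def S_def)
    show "residue ?f (pole k n) = - pole_coeff k * (twist multiplier m (1 / b k) n / (1 - b k * q powi n)\<^sup>2)"
    proof (rule residue_pole[OF k])
      \<comment> \<open>Removing the other singular points, including 1, isolates this pole.\<close>
      show "open (S - (pts - {pole k n}))"
        using S fin_pts by (intro open_Diff finite_imp_closed) auto
      show "1 \<notin> S - (pts - {pole k n})" using pole_neq_1[OF k, of n] by (auto simp: pts_def)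
      show "pole j l = pole k n" if "j \<in> {1..r + m}" "pole j l \<in> S - (pts - {pole k n})" for j l
        using that S_Z by (auto simp: pts_def)
    qed (use S1 \<open>pole k n \<in> S\<close> in auto)
  qed
  also have "\<dots> = (\<Sum>k=1..r + m. \<Sum>n | x < norm (pole k n) \<and> norm (pole k n) < y. - pole_coeff k *
      (twist multiplier m (1 / b k) n / (1 - b k * q powi n)\<^sup>2))"
    unfolding E_def using x y by (subst sum.Sigma) (auto intro: finite_poles_between)
  also have "\<dots> = - (\<Sum>k=1..r + m. pole_coeff k * (\<Sum>n | x < norm (pole k n) \<and> norm (pole k n) < y.
      twist multiplier m (1 / b k) n / (1 - b k * q powi n)\<^sup>2))"
    by (simp add: sum_distrib_left sum_negf)
  finally show ?thesis by simp
qed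

lemma summable_pole_series:
  assumes "k \<in> {1..r + m}"
  shows "(\<lambda>n. twist multiplier m (1 / b k) n / (1 - b k * q powi n)\<^sup>2) summable_on UNIV"
  by (rule summable_twist) (use assms b_nz b_neq_1 growth_mult multiplier_nz in auto)

lemma partial_fraction_squared:
  assumes a: "\<And>i. i \<in> {1..r} \<Longrightarrow> qbracket q (a i) \<noteq> 0"
  shows "F 1 * (1 - qS q r a + qS q (r + m) b) = (\<Sum>k=1..r + m. pole_coeff k *
           (\<Sum>\<^sub>\<infinity>n. twist multiplier m (1 / b k) n / (1 - b k * q powi n)\<^sup>2))"
proof -
  let ?f = "\<lambda>w. F w * w / (w - 1)\<^sup>2"
  let ?t = "\<lambda>k n. twist multiplier m (1 / b k) n / (1 - b k * q powi n)\<^sup>2"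
  obtain \<rho> where \<rho>: "norm q < \<rho>" "\<rho> < 1"
    and avoid: "\<And>k n N. k \<in> {1..r + m} \<Longrightarrow> norm (pole k n) \<noteq> \<rho> * norm q powi N"
    using circle_avoiding_poles by blast
  define x y where "x = (\<lambda>N. \<rho> * norm q ^ N)" and "y = (\<lambda>N. \<rho> / norm q ^ N)"
  have \<rho>0: "\<rho> > 0" using \<rho> q_pos by linarith
  have x: "0 < x N" "x N < 1" for N
  proof -
    have "x N \<le> \<rho>" using q_less \<rho>0 by (simp add: x_def mult_le_cancel_left1 power_le_one)
    thus "x N < 1" using \<rho> by simp
    show "0 < x N" using \<rho>0 q_pos by (simp add: x_def)
  qed
  have y: "1 < y N" if "N \<ge> 1" for N
  proof -
    have "norm q ^ N \<le> norm q" using power_decreasing[OF that, of "norm q"] q_less by simp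
    with \<rho> have "norm q ^ N < \<rho>" by simp
    thus ?thesis using q_pos by (simp add: y_def)
  qed
  define I where "I = (\<lambda>N k. {n. x N < norm (pole k n) \<and> norm (pole k n) < y N})"
  have cont: "continuous_on (sphere 0 \<rho>) F"
  proof (intro holomorphic_on_imp_continuous_on holomorphic_F)
    show "w \<noteq> pole k n" if "w \<in> sphere 0 \<rho>" "k \<in> {1..r + m}" for w k n
      using avoid[OF that(2), of n 0] that(1) by auto
  qed (use \<rho>0 in auto)
  have vanish: "(\<lambda>N. contour_integral (circlepath 0 (y N)) ?f - contour_integral (circlepath 0 (x N)) ?f) \<longlonglongrightarrow> 0 - 0"
    unfolding x_def y_def
    by (intro tendsto_diff circle_integrals_vanish[OF F_mult_q multiplier_nz \<rho> cont growth_mult])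
  \<comment> \<open>The double pole must lie between the circles; this starts at N = 1, since
    \<open>y 0\<close> is \<rho> < 1.\<close>
  have residues: "eventually (\<lambda>N. contour_integral (circlepath 0 (y N)) ?f - contour_integral (circlepath 0 (x N)) ?f
      = 2 * pi * \<i> * (F 1 * (1 - qS q r a + qS q (r + m) b)
         - (\<Sum>k=1..r + m. pole_coeff k * sum (?t k) (I N k)))) sequentially"
    using eventually_ge_at_top[of 1]
  proof eventually_elim
    case (elim N)
    show ?case unfolding I_def
    proof (rule annulus_residues[OF a x y[OF elim]])
      fix k n assume k: "k \<in> {1..r + m}"
      show "norm (pole k n) \<noteq> x N \<and> norm (pole k n) \<noteq> y N"
        using avoid[OF k, of n "int N"] avoid[OF k, of n "- int N"]
        by (simp add: x_def y_def power_int_minus divide_inverse)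
    qed
  qed
  have "(\<lambda>N. 2 * pi * \<i> * (F 1 * (1 - qS q r a + qS q (r + m) b)
         - (\<Sum>k=1..r + m. pole_coeff k * sum (?t k) (I N k)))) \<longlonglongrightarrow>
      2 * pi * \<i> * (F 1 * (1 - qS q r a + qS q (r + m) b) - (\<Sum>k=1..r + m. pole_coeff k * infsum (?t k) UNIV))"
  proof (intro tendsto_intros)
    fix k assume k: "k \<in> {1..r + m}"
    have "(sum (?t k) \<longlongrightarrow> infsum (?t k) UNIV) (finite_subsets_at_top UNIV)"
      using summable_pole_series[OF k] by (rule infsum_tendsto)
    \<comment> \<open>The ranges of n need not be symmetric about 0; it is enough that they are
      finite and eventually contain every finite set of indices.\<close>
    moreover have "filterlim (\<lambda>N. I N k) (finite_subsets_at_top UNIV) sequentially"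
      unfolding filterlim_finite_subsets_at_top
    proof (intro allI impI, elim conjE)
      fix X :: "int set" assume X: "finite X"
      have lim0: "(\<lambda>N. norm q ^ N) \<longlonglongrightarrow> 0" using q_less by (intro LIMSEQ_power_zero) auto
      have "eventually (\<lambda>N. \<forall>n\<in>X. n \<in> I N k) sequentially"
        unfolding eventually_ball_finite_distrib[OF X]
      proof
        fix n assume "n \<in> X"
        have p: "norm (pole k n) > 0" using pole_nz[OF k] by simp
        have "(\<lambda>N. \<rho> * norm q ^ N) \<longlonglongrightarrow> \<rho> * 0" by (intro tendsto_intros lim0)
        hence "eventually (\<lambda>N. x N < norm (pole k n)) sequentially"
          unfolding x_def by (rule order_tendstoD) (use p in simp)
        moreover have "eventually (\<lambda>N. norm q ^ N < \<rho> / norm (pole k n)) sequentially"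
          using lim0 by (rule order_tendstoD) (use p \<rho>0 in simp)
        ultimately show "eventually (\<lambda>N. n \<in> I N k) sequentially"
        proof eventually_elim
          case (elim N)
          have "norm (pole k n) < y N"
            using elim(2) p q_pos by (simp add: y_def field_simps)
          with elim(1) show ?case by (simp add: I_def)
        qed
      qed
      thus "\<forall>\<^sub>F N in sequentially. finite (I N k) \<and> X \<subseteq> I N k \<and> I N k \<subseteq> UNIV"
      proof eventually_elim
        case (elim N)
        have "finite (I N k)" unfolding I_def
          using \<rho>0 q_pos x by (intro finite_poles_between k) (auto simp: y_def)
        with elim show ?case by auto
      qed
    qed
    ultimately show "(\<lambda>N. sum (?t k) (I N k)) \<longlonglongrightarrow> infsum (?t k) UNIV"
      by (rule filterlim_compose)
  qed
  from LIMSEQ_unique[OF this Lim_transform_eventually[OF vanish residues]]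
  have "2 * pi * \<i> * (F 1 * (1 - qS q r a + qS q (r + m) b) - (\<Sum>k=1..r + m. pole_coeff k * infsum (?t k) UNIV)) = 0 - 0" .
  thus ?thesis by simp
qed

end

section \<open>Comparison with the bilateral series of the statement\<close>

lemma bilat_term_eq_twist:
  assumes "nome q" "k \<in> {1..r + m}" "\<And>i. i \<in> {1..r} \<Longrightarrow> a i \<noteq> 0" "\<And>k. k \<in> {1..r + m} \<Longrightarrow> b k \<noteq> 0"
  shows "bilat_term q r (r + m) a b k n =
    nome.twist q ((-1) ^ m * (\<Prod>k=1..r + m. b k) / (\<Prod>i=1..r. a i)) m (1 / b k) n / (1 - b k * q powi n)\<^sup>2"
proof -
  interpret nome q by fact
  define A B B' where "A = (\<Prod>i=1..r. a i)" and "B = (\<Prod>k=1..r + m. b k)"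
    and "B' = (\<Prod>j\<in>{1..r + m} - {k}. b j)"
  have B: "B = b k * B'" unfolding B_def B'_def using assms(2) by (simp add: prod.remove)
  have nz: "A \<noteq> 0" "B' \<noteq> 0" "b k \<noteq> 0" unfolding A_def B'_def using assms by auto
  have sgn: "((-1) ^ m * B / A) powi (- n) = (-1) powi (int m * n) * (A / B) powi n"
  proof -
    \<comment> \<open>The sign (-1)^m is its own inverse, so inverting the multiplier only exchanges
      A and B.\<close>
    have inv: "(-1) ^ m * B / A = inverse ((-1) ^ m * (A / B))"
      by (cases "even m") (simp_all add: field_simps)
    have "((-1) ^ m * B / A) powi (- n) = ((-1) ^ m * (A / B)) powi n"
      unfolding inv power_int_minus power_int_inverse inverse_inverse_eq ..
    thus ?thesis by (simp only: power_int_mult_distrib power_int_mult power_int_of_nat)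
  qed
  \<comment> \<open>Since B = b_k B', dividing by B' instead of B absorbs one power of b_k; for m =
    0 this is the exponent -1.\<close>
  have arg: "A * b k powi (int m - 1) / B' = (A / B) * b k ^ m"
    using nz by (simp add: B power_int_diff field_simps)
  have "(1 / b k) powi (- (int m * n)) = b k powi (int m * n)"
    unfolding inverse_eq_divide[symmetric] power_int_minus power_int_inverse inverse_inverse_eq ..
  hence pow: "(1 / b k) powi (- (int m * n)) = (b k ^ m) powi n"
    by (simp only: power_int_mult power_int_of_nat)
  have "int (r + m) - int r = int m" by simp
  thus ?thesis
    unfolding bilat_term_def twist_def A_def[symmetric] B_def[symmetric] B'_def[symmetric] sgn pow
    by (simp only: arg power_int_mult_distrib) simp
qed

text \<open>Summability is part of the conclusion because an infinite sum over a non-summable family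
  is 0 by convention; the identity alone would not assert convergence.\<close>

theorem theorem1p2:
  fixes q :: complex and r s :: nat and a b :: "nat \<Rightarrow> complex"
  assumes "0 < norm q" and "norm q < 1"
    and "\<And>i. i \<in> {1..r} \<Longrightarrow> a i \<noteq> 0"
    and "\<And>k. k \<in> {1..s} \<Longrightarrow> b k \<noteq> 0"
    and "qS_defined q r a" and "qS_defined q s b"
    and "(\<Prod>k=1..s. qbracket q (b k)) \<noteq> 0"
    and "\<And>k. k \<in> {1..s} \<Longrightarrow> (\<Prod>j\<in>{1..s} - {k}. qbracket q (b j / b k)) \<noteq> 0"
    and "\<And>k (n::int). k \<in> {1..s} \<Longrightarrow> 1 - b k * q powi n \<noteq> 0"
    and "r < s \<or>
         (r = s \<and> norm q < norm ((\<Prod>i=1..r. a i) / (\<Prod>k=1..s. b k))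
                \<and> norm ((\<Prod>i=1..r. a i) / (\<Prod>k=1..s. b k)) < 1)"
  shows "(\<forall>k\<in>{1..s}. bilat_term q r s a b k summable_on UNIV) \<and>
    (qpoch_inf q q)\<^sup>2 * (\<Prod>i=1..r. qbracket q (a i)) / (\<Prod>k=1..s. qbracket q (b k))
       * (1 - qS q r a + qS q s b)
     = (\<Sum>k=1..s. (\<Prod>i=1..r. qbracket q (a i / b k))
                 / (\<Prod>j\<in>{1..s} - {k}. qbracket q (b j / b k))
                 * (\<Sum>\<^sub>\<infinity>n\<in>UNIV. bilat_term q r s a b k n))"
proof -
  obtain m where s: "s = r + m" using assms(10) le_Suc_ex less_imp_le by (metis order_refl)
  interpret theta_quotient q r m a b
  proof
    show "b k * q powi n \<noteq> 1" if "k \<in> {1..r + m}" for k n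
      using assms(9)[of k n] that s by auto
    show "qbracket q (b j / b k) \<noteq> 0" if "k \<in> {1..r + m}" "j \<in> {1..r + m}" "j \<noteq> k" for k j
      using assms(8)[of k] that s by auto
  qed (use assms s in auto)
  \<comment> \<open>The denominators in S(a) are exactly the factors of the two products in [a_i],
    so definedness of S(a) makes these brackets nonzero.\<close>
  have a: "qbracket q (a i) \<noteq> 0" if "i \<in> {1..r}" for i
  proof -
    have "qpoch_inf (a i) q \<noteq> 0" "qpoch_inf (q / a i) q \<noteq> 0"
      using assms(5) that by (auto simp: qS_defined_def qpoch_eq_0_iff divide_inverse mult_ac)
    thus ?thesis by (simp add: qbracket_def)
  qed
  have bilat: "bilat_term q r s a b k = (\<lambda>n. twist multiplier m (1 / b k) n / (1 - b k * q powi n)\<^sup>2)"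
    if "k \<in> {1..s}" for k
    unfolding s multiplier_def
    by (rule ext, rule bilat_term_eq_twist) (use nome_axioms that s assms in auto)
  show ?thesis
  proof
    show "\<forall>k\<in>{1..s}. bilat_term q r s a b k summable_on UNIV"
    proof
      fix k assume k: "k \<in> {1..s}"
      show "bilat_term q r s a b k summable_on UNIV"
        unfolding bilat[OF k] by (rule summable_pole_series) (use k s in simp)
    qed
    show "(qpoch_inf q q)\<^sup>2 * (\<Prod>i=1..r. qbracket q (a i)) / (\<Prod>k=1..s. qbracket q (b k))
       * (1 - qS q r a + qS q s b)
     = (\<Sum>k=1..s. (\<Prod>i=1..r. qbracket q (a i / b k))
                 / (\<Prod>j\<in>{1..s} - {k}. qbracket q (b j / b k))
                 * (\<Sum>\<^sub>\<infinity>n\<in>UNIV. bilat_term q r s a b k n))"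
    proof -
      have "F 1 * (1 - qS q r a + qS q s b)
          = (\<Sum>k=1..s. pole_coeff k * infsum (bilat_term q r s a b k) UNIV)"
        unfolding s
        by (rule trans[OF partial_fraction_squared[OF a]], assumption, intro sum.cong refl)
          (simp only: bilat[unfolded s])
      thus ?thesis by (simp only: F_def pole_coeff_def s mult_1_right)
    qed
  qed
qed

end
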